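(* Let $k>2$ be an integer. Then the generic $k$-hypertournament has no transitive one-point extension.
   Context: **Extensions.** Let $\mathcal M$ be a first-order structure with universe $M$. A one-point extension of $\mathcal M$ is a first-order structure $\mathcal M'$ (in any language) with universe $M\cup\{0\}$, where $0\notin M$ is a new element, such that the stabilizer $\mathrm{Aut}(\mathcal M')_0$ of $0$, acting on $M$, equals $\mathrm{Aut}(\mathcal M)$ as a permutation group on $M$. It is a transitive one-point extension if $\mathrm{Aut}(\mathcal M')$ acts transitively on $M\cup\{0\}$. **Hypertournaments.** A $k$-hypertournament is a structure with one $k$-ary relation $T$, failing on tuples with repeated entries, such that for any set of $k$ elements, $T$ holds on exactly one ordering of its elements. The generic $k$-hypertournament is the Fraïssé limit of the class of finite $k$-hypertournaments, i.e. the unique (up to isomorphism) countable ultrahomogeneous structure whose age is the class of finite $k$-hypertournaments. *)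

theory Defs
  imports "HOL-Algebra.Group_Action" "HOL-Library.NList" "HOL-Library.Countable_Set"
begin

text \<open>
  The symbols of a language are given as sets, not as whole types, so that a language may lack
  function symbols or relation symbols; constants are function symbols of arity 0.
  The empty structure is allowed.
\<close>

record ('f, 'r) language =
  fun_syms :: "'f set"
  rel_syms :: "'r set"
  fun_arity :: "'f \<Rightarrow> nat"
  rel_arity :: "'r \<Rightarrow> nat"

record ('f, 'r, 'a) fo_structure =
  universe :: "'a set"
  fun_of :: "'f \<Rightarrow> 'a list \<Rightarrow> 'a"
  rel_of :: "'r \<Rightarrow> 'a list set"

definition fo_structure :: "('f, 'r) language \<Rightarrow> ('f, 'r, 'a) fo_structure \<Rightarrow> bool" where
  "fo_structure L M \<longleftrightarrow>
     (\<forall>f \<in> fun_syms L. \<forall>xs \<in> nlists (fun_arity L f) (universe M). fun_of M f xs \<in> universe M) \<and>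
     (\<forall>r \<in> rel_syms L. rel_of M r \<subseteq> nlists (rel_arity L r) (universe M))"

definition embedding ::
  "('f, 'r) language \<Rightarrow> ('f, 'r, 'a) fo_structure \<Rightarrow> ('f, 'r, 'b) fo_structure \<Rightarrow> ('a \<Rightarrow> 'b) \<Rightarrow> bool"
where
  "embedding L A B h \<longleftrightarrow>
     inj_on h (universe A) \<and> h ` universe A \<subseteq> universe B \<and>
     (\<forall>f \<in> fun_syms L. \<forall>xs \<in> nlists (fun_arity L f) (universe A).
        h (fun_of A f xs) = fun_of B f (map h xs)) \<and>
     (\<forall>r \<in> rel_syms L. \<forall>xs \<in> nlists (rel_arity L r) (universe A).
        xs \<in> rel_of A r \<longleftrightarrow> map h xs \<in> rel_of B r)"

definition isomorphism ::
  "('f, 'r) language \<Rightarrow> ('f, 'r, 'a) fo_structure \<Rightarrow> ('f, 'r, 'b) fo_structure \<Rightarrow> ('a \<Rightarrow> 'b) \<Rightarrow> bool"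
where
  "isomorphism L A B h \<longleftrightarrow> embedding L A B h \<and> h ` universe A = universe B"

text \<open>Membership in \<^term>\<open>Bij\<close> makes automorphisms extensional, that is, determined by their
  values on the universe.\<close>

definition Aut :: "('f, 'r) language \<Rightarrow> ('f, 'r, 'a) fo_structure \<Rightarrow> ('a \<Rightarrow> 'a) monoid" where
  "Aut L M = (BijGroup (universe M))
     \<lparr>carrier := {g \<in> Bij (universe M). isomorphism L M M g}\<rparr>"

definition subuniverse :: "('f, 'r) language \<Rightarrow> ('f, 'r, 'a) fo_structure \<Rightarrow> 'a set \<Rightarrow> bool" where
  "subuniverse L M A \<longleftrightarrow> A \<subseteq> universe M \<and>
     (\<forall>f \<in> fun_syms L. \<forall>xs \<in> nlists (fun_arity L f) A. fun_of M f xs \<in> A)"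

definition induced :: "('f, 'r, 'a) fo_structure \<Rightarrow> 'a set \<Rightarrow> ('f, 'r, 'a) fo_structure" where
  "induced M A = M\<lparr>universe := A, rel_of := \<lambda>r. rel_of M r \<inter> lists A\<rparr>"

definition generated :: "('f, 'r) language \<Rightarrow> ('f, 'r, 'a) fo_structure \<Rightarrow> 'a set \<Rightarrow> 'a set" where
  "generated L M S = \<Inter> {A. subuniverse L M A \<and> S \<subseteq> A}"

text \<open>For a language without function symbols, finitely generated just means finite.\<close>

definition finitely_generated :: "('f, 'r) language \<Rightarrow> ('f, 'r, 'a) fo_structure \<Rightarrow> bool" where
  "finitely_generated L M \<longleftrightarrow>
     (\<exists>S. finite S \<and> S \<subseteq> universe M \<and> generated L M S = universe M)"

definition ultrahomogeneous :: "('f, 'r) language \<Rightarrow> ('f, 'r, 'a) fo_structure \<Rightarrow> bool" where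
  "ultrahomogeneous L M \<longleftrightarrow>
     (\<forall>A B h. subuniverse L M A \<and> subuniverse L M B \<and>
        finitely_generated L (induced M A) \<and> finitely_generated L (induced M B) \<and>
        isomorphism L (induced M A) (induced M B) h \<longrightarrow>
        (\<exists>g \<in> carrier (Aut L M). \<forall>x \<in> A. g x = h x))"

text \<open>The members of the age are taken with elements in an independent type \<open>'b\<close>, since the
  age is closed under isomorphism.\<close>

definition age ::
  "('f, 'r) language \<Rightarrow> ('f, 'r, 'a) fo_structure \<Rightarrow> ('f, 'r, 'b) fo_structure set"
where
  "age L M = {A. fo_structure L A \<and> finitely_generated L A \<and> (\<exists>h. embedding L A M h)}"

definition hypertournament_lang :: "nat \<Rightarrow> (unit, unit) language" where
  "hypertournament_lang k =
     \<lparr>fun_syms = {}, rel_syms = {()}, fun_arity = (\<lambda>_. 0), rel_arity = (\<lambda>_. k)\<rparr>"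

definition hypertournament :: "nat \<Rightarrow> (unit, unit, 'a) fo_structure \<Rightarrow> bool" where
  "hypertournament k M \<longleftrightarrow>
     fo_structure (hypertournament_lang k) M \<and>
     (\<forall>xs \<in> rel_of M (). distinct xs) \<and>
     (\<forall>S. S \<subseteq> universe M \<and> finite S \<and> card S = k \<longrightarrow>
        (\<exists>!xs. set xs = S \<and> distinct xs \<and> xs \<in> rel_of M ()))"

text \<open>Every finite structure has an isomorphic copy with elements in \<^typ>\<open>nat\<close>, so both sides
  of the age equation below represent all isomorphism types. The generic \<open>k\<close>-hypertournament is
  unique only up to isomorphism, hence a predicate.\<close>

definition generic_hypertournament :: "nat \<Rightarrow> (unit, unit, 'a) fo_structure \<Rightarrow> bool" where
  "generic_hypertournament k M \<longleftrightarrow>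
     fo_structure (hypertournament_lang k) M \<and>
     countable (universe M) \<and>
     ultrahomogeneous (hypertournament_lang k) M \<and>
     age (hypertournament_lang k) M =
       {A :: (unit, unit, nat) fo_structure. hypertournament k A \<and> finite (universe A)}"

text \<open>Both sides of the last equation are sets of extensional permutations of the universe of
  \<open>M\<close>, composed in the same way.\<close>

definition one_point_extension ::
  "('f, 'r) language \<Rightarrow> ('f, 'r, 'a) fo_structure \<Rightarrow> 'a \<Rightarrow>
   ('g, 's) language \<Rightarrow> ('g, 's, 'a) fo_structure \<Rightarrow> bool"
where
  "one_point_extension L M z L' M' \<longleftrightarrow>
     fo_structure L' M' \<and>
     z \<notin> universe M \<and>
     universe M' = insert z (universe M) \<and>
     (\<lambda>g. restrict g (universe M)) ` stabilizer (Aut L' M') (\<lambda>g. g) z = carrier (Aut L M)"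

definition transitive_one_point_extension ::
  "('f, 'r) language \<Rightarrow> ('f, 'r, 'a) fo_structure \<Rightarrow> 'a \<Rightarrow>
   ('g, 's) language \<Rightarrow> ('g, 's, 'a) fo_structure \<Rightarrow> bool"
where
  "transitive_one_point_extension L M z L' M' \<longleftrightarrow>
     one_point_extension L M z L' M' \<and>
     transitive_action (Aut L' M') (universe M') (\<lambda>g. g)"

text \<open>Automorphisms do form a group acting on the universe, so the group-action part of
  \<^locale>\<open>transitive_action\<close> above holds for every structure.\<close>

lemma Aut_subgroup:
  assumes M: "fo_structure L M"
  shows "subgroup (carrier (Aut L M)) (BijGroup (universe M))"
proof -
  let ?U = "universe M"
  interpret G: group "BijGroup ?U" by (rule group_BijGroup)
  have car: "g \<in> carrier (Aut L M) \<longleftrightarrow> g \<in> Bij ?U \<and> isomorphism L M M g" for g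
    by (simp add: Aut_def)
  have fcl: "fun_of M f xs \<in> ?U" if "f \<in> fun_syms L" "xs \<in> nlists (fun_arity L f) ?U" for f xs
    using M that by (auto simp: fo_structure_def)
  have iso_iff: "isomorphism L M M g \<longleftrightarrow>
     (\<forall>f \<in> fun_syms L. \<forall>xs \<in> nlists (fun_arity L f) ?U. g (fun_of M f xs) = fun_of M f (map g xs)) \<and>
     (\<forall>r \<in> rel_syms L. \<forall>xs \<in> nlists (rel_arity L r) ?U. xs \<in> rel_of M r \<longleftrightarrow> map g xs \<in> rel_of M r)"
    if "g \<in> Bij ?U" for g
    using that by (auto simp: isomorphism_def embedding_def Bij_def bij_betw_def)
  have mapcl: "map g xs \<in> nlists n ?U" if "g \<in> Bij ?U" "xs \<in> nlists n ?U" for g xs n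
    using that(2) Bij_imp_funcset[OF that(1)] unfolding nlists_def by fastforce
  have comp: "compose ?U g h \<in> carrier (Aut L M)"
    if g: "g \<in> carrier (Aut L M)" and h: "h \<in> carrier (Aut L M)" for g h
  proof -
    have B: "g \<in> Bij ?U" "h \<in> Bij ?U" "compose ?U g h \<in> Bij ?U"
      using g h car compose_Bij by blast+
    have eq: "map (compose ?U g h) xs = map g (map h xs)" if "xs \<in> nlists n ?U" for xs n
      using nlistsE_set[OF that] by (simp add: compose_def subset_iff)
    note ig = g[unfolded car iso_iff[OF B(1)], THEN conjunct2]
    note ih = h[unfolded car iso_iff[OF B(2)], THEN conjunct2]
    have F: "compose ?U g h (fun_of M f xs) = fun_of M f (map (compose ?U g h) xs)"
      if "f \<in> fun_syms L" "xs \<in> nlists (fun_arity L f) ?U" for f xs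
    proof -
      have "compose ?U g h (fun_of M f xs) = g (h (fun_of M f xs))"
        using fcl[OF that] by (rule compose_eq)
      also have "\<dots> = g (fun_of M f (map h xs))" using ih that by metis
      also have "\<dots> = fun_of M f (map g (map h xs))" using ig that(1) mapcl[OF B(2) that(2)] by blast
      finally show ?thesis by (simp only: eq[OF that(2)])
    qed
    have R: "xs \<in> rel_of M r \<longleftrightarrow> map (compose ?U g h) xs \<in> rel_of M r"
      if "r \<in> rel_syms L" "xs \<in> nlists (rel_arity L r) ?U" for r xs
    proof -
      have "xs \<in> rel_of M r \<longleftrightarrow> map h xs \<in> rel_of M r" using ih that by blast
      also have "\<dots> \<longleftrightarrow> map g (map h xs) \<in> rel_of M r"
        using ig that(1) mapcl[OF B(2) that(2)] by blast
      finally show ?thesis by (simp only: eq[OF that(2)])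
    qed
    show ?thesis unfolding car iso_iff[OF B(3)] using B(3) F R by blast
  qed
  have invB: "inv\<^bsub>BijGroup ?U\<^esub> g = restrict (inv_into ?U g) ?U" if "g \<in> Bij ?U" for g
    using that by (rule inv_BijGroup)
  have inv: "restrict (inv_into ?U g) ?U \<in> carrier (Aut L M)" (is "?h \<in> _")
    if g: "g \<in> carrier (Aut L M)" for g
  proof -
    have B: "g \<in> Bij ?U" "?h \<in> Bij ?U" using g car restrict_inv_into_Bij by blast+
    have hg: "?h (g x) = x" "g (?h x) = x" if "x \<in> ?U" for x
      using B(1) that by (auto simp: Bij_def bij_betw_def f_inv_into_f)
    have eq: "map g (map ?h xs) = xs" if "xs \<in> nlists n ?U" for xs n
      using nlistsE_set[OF that] hg(2) by (simp add: map_idI subset_iff del: restrict_apply)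
    note ih = g[unfolded car iso_iff[OF B(1)], THEN conjunct2]
    have F: "?h (fun_of M f xs) = fun_of M f (map ?h xs)"
      if "f \<in> fun_syms L" "xs \<in> nlists (fun_arity L f) ?U" for f xs
    proof -
      have "g (fun_of M f (map ?h xs)) = fun_of M f (map g (map ?h xs))"
        using ih that mapcl[OF B(2) that(2)] by blast
      also have "\<dots> = fun_of M f xs" by (simp only: eq[OF that(2)])
      finally show ?thesis using hg(1) fcl[OF that(1) mapcl[OF B(2) that(2)]] by metis
    qed
    have R: "xs \<in> rel_of M r \<longleftrightarrow> map ?h xs \<in> rel_of M r"
      if "r \<in> rel_syms L" "xs \<in> nlists (rel_arity L r) ?U" for r xs
    proof -
      have "map ?h xs \<in> rel_of M r \<longleftrightarrow> map g (map ?h xs) \<in> rel_of M r"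
        using ih that mapcl[OF B(2) that(2)] by blast
      thus ?thesis by (simp only: eq[OF that(2)])
    qed
    show ?thesis unfolding car iso_iff[OF B(2)] using B(2) F R by blast
  qed
  have one: "(\<lambda>x\<in>?U. x) \<in> carrier (Aut L M)"
  proof -
    have "map (\<lambda>x\<in>?U. x) xs = xs" if "xs \<in> nlists n ?U" for xs n
      using nlistsE_set[OF that] by (simp add: map_idI subset_iff)
    thus ?thesis unfolding car iso_iff[OF id_Bij] using id_Bij fcl by simp
  qed
  show ?thesis
  proof (rule G.subgroupI)
    show "carrier (Aut L M) \<subseteq> carrier (BijGroup ?U)"
      by (auto simp: Aut_def BijGroup_def)
    show "carrier (Aut L M) \<noteq> {}" using one by blast
    show "inv\<^bsub>BijGroup ?U\<^esub> g \<in> carrier (Aut L M)" if "g \<in> carrier (Aut L M)" for g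
      using that inv invB car by simp
    show "g \<otimes>\<^bsub>BijGroup ?U\<^esub> h \<in> carrier (Aut L M)"
      if "g \<in> carrier (Aut L M)" "h \<in> carrier (Aut L M)" for g h
      using comp[OF that] that car by (simp add: BijGroup_def)
  qed
qed

lemma Aut_group_action:
  assumes "fo_structure L M"
  shows "group_action (Aut L M) (universe M) (\<lambda>g. g)"
proof -
  let ?B = "BijGroup (universe M)"
  have eq: "Aut L M = ?B\<lparr>carrier := carrier (Aut L M)\<rparr>" by (simp add: Aut_def)
  have sub: "subgroup (carrier (Aut L M)) ?B" using Aut_subgroup[OF assms] .
  have grp: "group (Aut L M)"
    using subgroup.subgroup_is_group[OF sub group_BijGroup] eq by simp
  have "(\<lambda>g. g) \<in> hom (Aut L M) ?B"
    using subgroup.subset[OF sub] by (auto simp: hom_def Aut_def)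
  thus ?thesis
    using grp group_BijGroup
    by (simp add: group_action_def group_hom_def group_hom_axioms_def)
qed

end

theory Submission
  imports Defs "HOL-Combinatorics.Permutations"
begin

text \<open>
  Let \<open>G\<close> be the automorphism group of a transitive one-point extension and \<open>n = k + 1\<close>.
  By transitivity and homogeneity, the \<open>G\<close>-orbit of a finite tuple is determined by the orbits of
  its \<open>n\<close>-element subtuples through one fixed coordinate, and these can be prescribed freely; so
  on \<open>n + 1\<close> points the \<open>n + 1\<close> orbits of \<open>n\<close>-subtuples form a Latin hypercube.
  Consistency on \<open>n + 2\<close> points makes this hypercube behave like the equation
  \<open>x\<^sub>0 + \<dots> + x\<^sub>n = 0\<close> in an abelian group: a change in one coordinate can be transported to a
  compensating change in another one, independently of all remaining coordinates.  Transporting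
  a change to an \<open>n\<close>-set avoiding two points \<open>i, j\<close> shows that the transposition \<open>(i j)\<close>
  reverses every change, so even permutations of the coordinates preserve all of them; hence an
  even permutation fixing one orbit of \<open>n\<close>-tuples fixes all of them.
  Some orbit is fixed by an \<open>n\<close>-cycle \<open>c\<close>, so \<open>c\<^sup>2\<close> fixes every orbit, and conjugating by a
  transposition \<open>h\<close> shows that \<open>h c\<^sup>2 h c\<^sup>-\<^sup>1\<close> fixes that orbit.
  A permutation of the coordinates that fixes an orbit of \<open>n\<close>-tuples and one coordinate is the
  identity, since a hypertournament on \<open>k\<close> points is rigid.  For \<open>n \<ge> 4\<close> this is violated.
\<close>

(* Together with nlists_def these two simp rules make the simplifier loop. *)
declare nlistsE_length [simp del] nlistsE_set [simp del]

section \<open>Orbits of tuples as an abstract equivalence\<close>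

text \<open>Intended reading: a tuple indexed by the finite set \<open>S\<close> is the restriction of a function to
  \<open>S\<close>, and \<open>sim S a b\<close> says that \<open>a\<close> and \<open>b\<close> are injective on \<open>S\<close> and lie in the same orbit.
  So \<open>sim S a a\<close> just says that \<open>a\<close> is a legitimate \<open>S\<close>-tuple.\<close>

locale tuple_types =
  fixes sim :: "nat set \<Rightarrow> (nat \<Rightarrow> 'a) \<Rightarrow> (nat \<Rightarrow> 'a) \<Rightarrow> bool" and n :: nat
  assumes sym: "sim S a b \<Longrightarrow> sim S b a"
    and trans: "sim S a b \<Longrightarrow> sim S b c \<Longrightarrow> sim S a c"
    and relabel: "sim S a b \<Longrightarrow> inj_on g T \<Longrightarrow> g ` T \<subseteq> S \<Longrightarrow> sim T (a \<circ> g) (b \<circ> g)"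
    and cong: "sim S a a \<Longrightarrow> (\<And>i. i \<in> S \<Longrightarrow> a i = b i) \<Longrightarrow> sim S a b"
    and determined: "finite F \<Longrightarrow> i \<in> F \<Longrightarrow> sim F a a \<Longrightarrow> sim F b b \<Longrightarrow>
      (\<And>S. S \<subseteq> F \<Longrightarrow> i \<in> S \<Longrightarrow> card S = n \<Longrightarrow> sim S a b) \<Longrightarrow> sim F a b"
    and free: "finite F \<Longrightarrow> i \<in> F \<Longrightarrow>
      (\<And>S. S \<in> \<S> \<Longrightarrow> S \<subseteq> F \<and> i \<in> S \<and> card S = n \<and> sim S (B S) (B S)) \<Longrightarrow>
      \<exists>a. sim F a a \<and> (\<forall>S\<in>\<S>. sim S a (B S))"
    and semiregular: "card S = n \<Longrightarrow> \<sigma> permutes S \<Longrightarrow> i \<in> S \<Longrightarrow> \<sigma> i = i \<Longrightarrow> sim S (x \<circ> \<sigma>) x \<Longrightarrow> \<sigma> = id"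
    and n_ge_4: "4 \<le> n"
begin

section \<open>Gluing tuples along faces\<close>

lemma mono: "sim S a b \<Longrightarrow> T \<subseteq> S \<Longrightarrow> sim T a b"
  using relabel[of S a b id T] by simp

text \<open>The \<open>n\<close>-subsets of \<open>F\<close> through \<open>i\<close> are exactly
  the facets \<open>F - {j}\<close> with \<open>j \<noteq> i\<close>. So the facet
  \<open>F - {i}\<close> is forced by the other \<open>n\<close> facets, which is the Latin
  hypercube property.\<close>

lemma determined_Suc:
  assumes F: "card F = Suc n" "i \<in> F" and ab: "sim F a a" "sim F b b"
    and *: "\<And>j. j \<in> F \<Longrightarrow> j \<noteq> i \<Longrightarrow> sim (F - {j}) a b"
  shows "sim F a b"
proof (rule determined[OF _ F(2) ab])
  show fin: "finite F" using F(1) by (simp add: card_ge_0_finite)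
  fix S assume S: "S \<subseteq> F" "i \<in> S" "card S = n"
  have "card (F - S) = 1"
    using S F(1) fin by (simp add: card_Diff_subset finite_subset)
  then obtain j where "F - S = {j}" by (auto simp: card_Suc_eq)
  hence "S = F - {j}" "j \<in> F" "j \<noteq> i" using S by auto
  thus "sim S a b" using * by simp
qed

text \<open>The point \<open>d\<close> lies in every face \<open>H - {v}\<close> with
  \<open>v \<in> V\<close>, so it can serve as base point for \<open>free\<close>. An
  \<open>n\<close>-set missing two points \<open>v\<close>, \<open>w\<close> of \<open>V\<close>
  equals \<open>H - {v, w}\<close>, and there \<open>pp\<close> makes the two candidate values
  agree; this is why the arbitrary choice \<open>f\<close> is harmless.\<close>

lemma glue:
  assumes H: "card H = Suc (Suc n)" and V: "V \<subseteq> H" and d: "d \<in> H - V"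
    and p: "\<And>v. v \<in> V \<Longrightarrow> sim (H - {v}) (p v) (p v)"
    and pp: "\<And>v w. v \<in> V \<Longrightarrow> w \<in> V \<Longrightarrow> v \<noteq> w \<Longrightarrow> sim (H - {v, w}) (p v) (p w)"
  shows "\<exists>m. sim H m m \<and> (\<forall>v\<in>V. sim (H - {v}) m (p v))"
proof -
  have fin: "finite H" using H by (simp add: card_ge_0_finite)
  define \<S> where "\<S> = {S. S \<subseteq> H \<and> d \<in> S \<and> card S = n \<and> (\<exists>v\<in>V. v \<notin> S)}"
  define f where "f S = (SOME v. v \<in> V \<and> v \<notin> S)" for S
  have f: "f S \<in> V" "f S \<notin> S" if "S \<in> \<S>" for S
    using someI_ex[of "\<lambda>v. v \<in> V \<and> v \<notin> S"] that unfolding \<S>_def f_def by blast+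
  have "\<exists>m. sim H m m \<and> (\<forall>S\<in>\<S>. sim S m (p (f S)))"
  proof (rule free[OF fin])
    show "d \<in> H" using d by simp
    fix S assume S: "S \<in> \<S>"
    have "sim S (p (f S)) (p (f S))"
      by (rule mono[OF p[OF f(1)[OF S]]]) (use S f(2)[OF S] \<S>_def in auto)
    thus "S \<subseteq> H \<and> d \<in> S \<and> card S = n \<and> sim S (p (f S)) (p (f S))"
      using S by (auto simp: \<S>_def)
  qed
  then obtain m where m: "sim H m m" "\<And>S. S \<in> \<S> \<Longrightarrow> sim S m (p (f S))" by blast
  have "sim (H - {v}) m (p v)" if v: "v \<in> V" for v
  proof (rule determined_Suc[of _ d])
    show "card (H - {v}) = Suc n" using H v V fin by (simp add: card_Diff_singleton subset_iff)
    show "d \<in> H - {v}" using d v by auto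
    show "sim (H - {v}) m m" using mono[OF m(1)] by auto
    show "sim (H - {v}) (p v) (p v)" using p[OF v] .
    fix j assume j: "j \<in> H - {v}" "j \<noteq> d"
    let ?S = "H - {v} - {j}"
    have S: "?S \<in> \<S>" using H v V fin j d by (auto simp: \<S>_def card_Diff_singleton subset_iff)
    have "f ?S = v \<or> f ?S = j" using f[OF S] V by auto
    thus "sim ?S m (p v)"
    proof
      assume "f ?S = j"
      moreover from this have "sim (H - {j, v}) (p j) (p v)" using pp f(1)[OF S] v j by auto
      moreover have "H - {j, v} = ?S" by auto
      ultimately show ?thesis using m(2)[OF S] trans by metis
    qed (use m(2)[OF S] in simp)
  qed
  thus ?thesis using m(1) by blast
qed

text \<open>The change \<open>x \<mapsto> x'\<close> on \<open>F - {s}\<close> is compensated by the change \<open>z \<mapsto> z'\<close> on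
  \<open>F - {t}\<close>.\<close>

definition shift where
  "shift F s t x x' z z' \<longleftrightarrow>
     (\<exists>p p'. sim F p p \<and> sim F p' p' \<and> sim (F - {s}) p x \<and> sim (F - {t}) p z \<and>
        sim (F - {s}) p' x' \<and> sim (F - {t}) p' z' \<and> (\<forall>u\<in>F - {s, t}. sim (F - {u}) p p'))"

section \<open>Uniqueness of the compensating change\<close>

text \<open>With base point \<open>t\<close>, all \<open>n\<close>-sets through \<open>t\<close>
  keep their value from \<open>m\<close>, except \<open>H - {v, s}\<close>, which takes its value
  from \<open>p'\<close>. A face \<open>H - {i}\<close> with \<open>i\<close> outside
  \<open>{v, s, t}\<close> does not contain \<open>H - {v, s}\<close>, so it is unchanged; only the
  faces opposite \<open>v\<close>, \<open>s\<close>, \<open>t\<close> may move.\<close>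

lemma lift_change:
  assumes H: "card H = Suc (Suc n)" and vst: "{v, s, t} \<subseteq> H" "v \<noteq> s" "v \<noteq> t" "s \<noteq> t"
    and m: "sim H m m" and p: "sim (H - {v}) p' p'"
    and pp: "\<And>u. u \<in> H - {v, s, t} \<Longrightarrow> sim (H - {v, u}) m p'"
  shows "\<exists>m'. sim H m' m' \<and> sim (H - {v}) m' p' \<and> (\<forall>i\<in>H - {v, s, t}. sim (H - {i}) m m')"
proof -
  have fin: "finite H" using H by (simp add: card_ge_0_finite)
  define \<S> where "\<S> = {S. S \<subseteq> H \<and> t \<in> S \<and> card S = n}"
  have "\<exists>m'. sim H m' m' \<and> (\<forall>S\<in>\<S>. sim S m' (if S = H - {v, s} then p' else m))"
  proof (rule free[OF fin])
    show "t \<in> H" using vst by simp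
    fix S assume S: "S \<in> \<S>"
    have "sim (H - {v, s}) p' p'" by (rule mono[OF p]) auto
    moreover have "sim S m m" using mono[OF m] S \<S>_def by auto
    ultimately show "S \<subseteq> H \<and> t \<in> S \<and> card S = n \<and>
        sim S (if S = H - {v, s} then p' else m) (if S = H - {v, s} then p' else m)"
      using S by (auto simp: \<S>_def)
  qed
  then obtain m' where m': "sim H m' m'"
    and S: "\<And>S. S \<in> \<S> \<Longrightarrow> sim S m' (if S = H - {v, s} then p' else m)" by blast
  have card1: "card (H - {i}) = Suc n" if "i \<in> H" for i
    using H that fin by (simp add: card_Diff_singleton)
  have inS: "H - {i} - {j} \<in> \<S>" if "i \<in> H" "j \<in> H - {i}" "i \<noteq> t" "j \<noteq> t" for i j
    using that H vst fin by (auto simp: \<S>_def card_Diff_singleton)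
  have star: "sim (H - {i}) m m'" if i: "i \<in> H - {v, s, t}" for i
  proof (rule determined_Suc[of _ t])
    fix j assume j: "j \<in> H - {i}" "j \<noteq> t"
    have "H - {i} - {j} \<noteq> H - {v, s}" using i by blast
    thus "sim (H - {i} - {j}) m m'" using S[OF inS[of i j]] i j sym by auto
  qed (use i vst card1 mono[OF m] mono[OF m'] in auto)
  have "sim (H - {v}) m' p'"
  proof (rule determined_Suc[of _ t])
    fix j assume j: "j \<in> H - {v}" "j \<noteq> t"
    show "sim (H - {v} - {j}) m' p'"
    proof (cases "j = s")
      case True
      have "H - {v} - {s} = H - {v, s}" by auto
      thus ?thesis using S[OF inS[of v s]] j True vst by auto
    next
      case False
      have e: "H - {v} - {j} = H - {v, j}" by auto
      have "sim (H - {v, j}) m' m"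
        by (rule mono[OF sym[OF star[of j]]]) (use j False in auto)
      thus ?thesis unfolding e using pp[of j] j False trans by blast
    qed
  qed (use vst card1 mono[OF m'] p in auto)
  with star m' show ?thesis by blast
qed

text \<open>Both changes are lifted from the face \<open>H - {v}\<close> to \<open>H\<close>, from
  starting points that agree on the faces opposite \<open>s\<close> and \<open>t\<close>. As the
  lifts alter only the faces opposite \<open>v\<close>, \<open>s\<close>, \<open>t\<close>, the
  results agree first on \<open>H - {s}\<close> and then on \<open>H - {t}\<close>.\<close>

lemma shift_unique_aux:
  assumes H: "card H = Suc (Suc n)" and vst: "{v, s, t} \<subseteq> H" "v \<noteq> s" "v \<noteq> t" "s \<noteq> t"
    and p: "sim (H - {v}) p p" "sim (H - {v}) p' p'" "\<And>u. u \<in> H - {v, s, t} \<Longrightarrow> sim (H - {v, u}) p p'"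
    and q: "sim (H - {v}) q q" "sim (H - {v}) q' q'" "\<And>u. u \<in> H - {v, s, t} \<Longrightarrow> sim (H - {v, u}) q q'"
    and pq: "sim (H - {v, s}) p q" "sim (H - {v, t}) p q" "sim (H - {v, s}) p' q'"
  shows "sim (H - {v, t}) p' q'"
proof -
  have fin: "finite H" using H by (simp add: card_ge_0_finite)
  have card1: "card (H - {i}) = Suc n" if "i \<in> H" for i
    using H that fin by (simp add: card_Diff_singleton)
  have "card {v, s, t} < card H" using H n_ge_4 by (simp add: card_insert_if)
  then obtain d where d: "d \<in> H - {v, s, t}"
    using card_mono[of "{v, s, t}" H] by fastforce
  obtain m where m: "sim H m m" "sim (H - {v}) m p"
    using glue[OF H, of "{v}" d "\<lambda>_. p"] vst d p(1) by auto
  \<comment> \<open>\<open>mq\<close> is a starting point above \<open>q\<close> that shares the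
    faces opposite \<open>s\<close> and \<open>t\<close> with \<open>m\<close>. The first two parts
    of \<open>pq\<close> are the compatibility that gluing requires.\<close>
  have "\<exists>mq. sim H mq mq \<and> (\<forall>u\<in>{v, s, t}. sim (H - {u}) mq (if u = v then q else m))"
  proof (rule glue[OF H vst(1) d])
    fix u assume "u \<in> {v, s, t}"
    show "sim (H - {u}) (if u = v then q else m) (if u = v then q else m)"
      using q(1) mono[OF m(1)] by auto
  next
    fix u w assume uw: "u \<in> {v, s, t}" "w \<in> {v, s, t}" "u \<noteq> w"
    have 1: "sim (H - {v, r}) q m" if "r = s \<or> r = t" for r
    proof -
      have "sim (H - {v, r}) m p" using mono[OF m(2)] by auto
      moreover have "sim (H - {v, r}) p q" using pq that by auto
      ultimately show ?thesis by (rule sym[OF trans])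
    qed
    have 2: "sim (H - {r, v}) m q" if "r = s \<or> r = t" for r
      using sym[OF 1[OF that]] by (simp add: insert_commute)
    show "sim (H - {u, w}) (if u = v then q else m) (if w = v then q else m)"
      using uw 1 2 mono[OF m(1), of "H - {u, w}"] vst by auto
  qed
  then obtain mq where mq: "sim H mq mq" "sim (H - {v}) mq q" "sim (H - {s}) mq m" "sim (H - {t}) mq m"
    using vst by fastforce
  have mp': "sim (H - {v, u}) m p'" if "u \<in> H - {v, s, t}" for u
    using trans[OF mono[OF m(2)] p(3)[OF that]] by auto
  have mq': "sim (H - {v, u}) mq q'" if "u \<in> H - {v, s, t}" for u
    using trans[OF mono[OF mq(2)] q(3)[OF that]] by auto
  obtain m' where m': "sim H m' m'" "sim (H - {v}) m' p'" "\<And>i. i \<in> H - {v, s, t} \<Longrightarrow> sim (H - {i}) m m'"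
    using lift_change[OF H vst m(1) p(2) mp'] by blast
  obtain n' where n': "sim H n' n'" "sim (H - {v}) n' q'" "\<And>i. i \<in> H - {v, s, t} \<Longrightarrow> sim (H - {i}) mq n'"
    using lift_change[OF H vst mq(1) q(2) mq'] by blast
  have other: "sim (H - {r} - {j}) m' n'" if "r = s \<or> r = t" "j \<in> H - {v, s, t}" for r j
  proof -
    have "sim (H - {r} - {j}) m' m" by (rule mono[OF sym[OF m'(3)[OF that(2)]]]) auto
    moreover have "sim (H - {r} - {j}) m mq"
      by (rule mono[of "H - {r}"]) (use sym[OF mq(3)] sym[OF mq(4)] that(1) in auto)
    moreover have "sim (H - {r} - {j}) mq n'" by (rule mono[OF n'(3)[OF that(2)]]) auto
    ultimately show ?thesis by (rule trans[OF trans])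
  qed
  have s: "sim (H - {s}) m' n'"
  proof (rule determined_Suc[of _ t])
    fix j assume j: "j \<in> H - {s}" "j \<noteq> t"
    show "sim (H - {s} - {j}) m' n'"
    proof (cases "j = v")
      case True
      have "H - {s} - {v} = H - {v, s}" by auto
      moreover have "sim (H - {v, s}) m' p'" "sim (H - {v, s}) n' q'"
        by (rule mono[OF m'(2)], blast, rule mono[OF n'(2)], blast)
      ultimately show ?thesis using True trans[OF trans[OF _ pq(3)] sym] by simp
    qed (use j other in auto)
  qed (use vst card1 mono[OF m'(1)] mono[OF n'(1)] in auto)
  \<comment> \<open>Base point \<open>v\<close> leaves out exactly the facet
    \<open>H - {t} - {v}\<close>, where agreement is wanted; it is forced by the other
    facets.\<close>
  have "sim (H - {t}) m' n'"
  proof (rule determined_Suc[of _ v])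
    fix j assume j: "j \<in> H - {t}" "j \<noteq> v"
    show "sim (H - {t} - {j}) m' n'"
    proof (cases "j = s")
      case True
      show ?thesis unfolding True by (rule mono[OF s]) auto
    qed (use j other in auto)
  qed (use vst card1 mono[OF m'(1)] mono[OF n'(1)] in auto)
  hence "sim (H - {v, t}) m' n'" by (rule mono) auto
  moreover have "sim (H - {v, t}) m' p'" "sim (H - {v, t}) n' q'"
    by (rule mono[OF m'(2)], blast, rule mono[OF n'(2)], blast)
  ultimately show ?thesis using trans[OF trans[OF sym]] by blast
qed

text \<open>A fresh index \<open>v\<close> turns \<open>F\<close> into a face of a set with
  \<open>n + 2\<close> points. Consistency there shows that \<open>z'\<close> depends, up to orbit,
  only on \<open>x\<close>, \<open>x'\<close> and \<open>z\<close>, and not on the remaining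
  facets.\<close>

lemma shift_unique:
  assumes F: "card F = Suc n" "s \<in> F" "t \<in> F" "s \<noteq> t"
    and sh: "shift F s t x x' z z'" "shift F s t y y' w w'"
    and xy: "sim (F - {s}) x y" "sim (F - {s}) x' y'" "sim (F - {t}) z w"
  shows "sim (F - {t}) z' w'"
proof -
  have fin: "finite F" using F by (simp add: card_ge_0_finite)
  obtain v where v: "v \<notin> F" using ex_new_if_finite[OF infinite_UNIV_nat fin] by blast
  let ?H = "insert v F"
  have e: "?H - {v} = F" "\<And>u. ?H - {v, u} = F - {u}" "?H - {v, s, t} = F - {s, t}" using v by auto
  obtain p p' where p: "sim F p p" "sim F p' p'" "sim (F - {s}) p x" "sim (F - {t}) p z"
     "sim (F - {s}) p' x'" "sim (F - {t}) p' z'" "\<And>u. u\<in>F - {s, t} \<Longrightarrow> sim (F - {u}) p p'"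
    using sh(1) unfolding shift_def by blast
  obtain q q' where q: "sim F q q" "sim F q' q'" "sim (F - {s}) q y" "sim (F - {t}) q w"
     "sim (F - {s}) q' y'" "sim (F - {t}) q' w'" "\<And>u. u\<in>F - {s, t} \<Longrightarrow> sim (F - {u}) q q'"
    using sh(2) unfolding shift_def by blast
  have "sim (?H - {v, t}) p' q'"
  proof (rule shift_unique_aux[where s = s and p = p and q = q])
    show "card ?H = Suc (Suc n)" using v fin F by simp
    show "v \<noteq> s" "v \<noteq> t" "s \<noteq> t" "{v, s, t} \<subseteq> ?H" using F v by auto
    show "sim (?H - {v, s}) p q" "sim (?H - {v, t}) p q" "sim (?H - {v, s}) p' q'"
      unfolding e using trans[OF trans[OF p(3) xy(1)] sym[OF q(3)]]
        trans[OF trans[OF p(4) xy(3)] sym[OF q(4)]] trans[OF trans[OF p(5) xy(2)] sym[OF q(5)]] by blast+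
  qed (simp_all add: e p(1,2,7) q(1,2,7))
  thus ?thesis unfolding e using trans[OF trans[OF sym[OF p(6)]] q(6)] by blast
qed

section \<open>Existence and composition of shifts\<close>

lemma refl: "sim S a b \<Longrightarrow> sim S a a" "sim S a b \<Longrightarrow> sim S b b"
  using trans sym by blast+

lemma ex_fourth:
  assumes "card F = Suc n"
  shows "\<exists>d. d \<in> F - {s, t, u}"
proof -
  have "card {s, t, u} < card F" using assms n_ge_4 by (simp add: card_insert_if)
  thus ?thesis using card_mono[of "{s, t, u}" F] by fastforce
qed

text \<open>Since \<open>n + 1 > 3\<close>, there is a point of \<open>F\<close> besides
  \<open>s\<close>, \<open>t\<close>, \<open>u\<close>. It lies in all three facets, so they can be
  prescribed independently with that base point.\<close>

lemma ex_point:
  assumes F: "card F = Suc n" "s \<in> F" "t \<in> F" "u \<in> F" and stu: "s \<noteq> t" "s \<noteq> u" "t \<noteq> u"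
    and x: "sim (F - {s}) x x" and y: "sim (F - {t}) y y" and z: "sim (F - {u}) z z"
  shows "\<exists>p. sim F p p \<and> sim (F - {s}) p x \<and> sim (F - {t}) p y \<and> sim (F - {u}) p z"
proof -
  have fin: "finite F" using F by (simp add: card_ge_0_finite)
  obtain d where d: "d \<in> F - {s, t, u}" using ex_fourth[OF F(1)] by blast
  define B where "B S = (if s \<notin> S then x else if t \<notin> S then y else z)" for S :: "nat set"
  have B: "B (F - {s}) = x" "B (F - {t}) = y" "B (F - {u}) = z"
    using F stu by (auto simp: B_def)
  have "\<exists>p. sim F p p \<and> (\<forall>S\<in>{F - {s}, F - {t}, F - {u}}. sim S p (B S))"
  proof (rule free[OF fin])
    show "d \<in> F" using d by simp
    fix S assume S: "S \<in> {F - {s}, F - {t}, F - {u}}"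
    hence "sim S (B S) (B S)" using B x y z by auto
    thus "S \<subseteq> F \<and> d \<in> S \<and> card S = n \<and> sim S (B S) (B S)"
      using S d F fin by (auto simp: card_Diff_singleton)
  qed
  thus ?thesis using B by auto
qed

text \<open>With base point \<open>t\<close> all facets but \<open>F - {t}\<close> can be
  prescribed, and that facet absorbs the change made at \<open>F - {s}\<close>.\<close>

lemma ex_change:
  assumes F: "card F = Suc n" "s \<in> F" "t \<in> F" "s \<noteq> t"
    and p: "sim F p p" and x: "sim (F - {s}) x x"
  shows "\<exists>q. sim F q q \<and> sim (F - {s}) q x \<and> (\<forall>r\<in>F - {s, t}. sim (F - {r}) p q)"
proof -
  have fin: "finite F" using F by (simp add: card_ge_0_finite)
  define B where "B S = (if s \<notin> S then x else p)" for S :: "nat set"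
  have "\<exists>q. sim F q q \<and> (\<forall>S\<in>{F - {r} | r. r \<in> F - {t}}. sim S q (B S))"
  proof (rule free[OF fin F(3)])
    fix S assume "S \<in> {F - {r} | r. r \<in> F - {t}}"
    then obtain r where r: "S = F - {r}" "r \<in> F - {t}" by blast
    have "sim S (B S) (B S)" using x mono[OF p, of S] F r by (cases "r = s") (auto simp: B_def)
    thus "S \<subseteq> F \<and> t \<in> S \<and> card S = n \<and> sim S (B S) (B S)"
      using r F by (auto simp: card_Diff_singleton fin)
  qed
  then obtain q where q: "sim F q q" "\<And>r. r \<in> F - {t} \<Longrightarrow> sim (F - {r}) q (B (F - {r}))" by blast
  have "sim (F - {s}) q x" using q(2)[of s] F by (simp add: B_def)
  moreover have "sim (F - {r}) p q" if "r \<in> F - {s, t}" for r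
    using sym[OF q(2)[of r]] F that by (auto simp: B_def)
  ultimately show ?thesis using q(1) by blast
qed

lemma shiftI:
  assumes "sim F p p" "sim F p' p'" "sim (F - {s}) p x" "sim (F - {t}) p z"
    "sim (F - {s}) p' x'" "sim (F - {t}) p' z'" "\<And>u. u \<in> F - {s, t} \<Longrightarrow> sim (F - {u}) p p'"
  shows "shift F s t x x' z z'"
  using assms unfolding shift_def by blast

lemma shift_cong:
  assumes "shift F s t x x' z z'"
    and "sim (F - {s}) x y" "sim (F - {s}) x' y'" "sim (F - {t}) z w" "sim (F - {t}) z' w'"
  shows "shift F s t y y' w w'"
proof -
  obtain p p' where p: "sim F p p" "sim F p' p'" "sim (F - {s}) p x" "sim (F - {t}) p z"
     "sim (F - {s}) p' x'" "sim (F - {t}) p' z'" "\<And>u. u\<in>F - {s, t} \<Longrightarrow> sim (F - {u}) p p'"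
    using assms(1) unfolding shift_def by blast
  show ?thesis
    by (rule shiftI[OF p(1,2) trans[OF p(3)] trans[OF p(4)] trans[OF p(5)] trans[OF p(6)] p(7)])
      (use assms in auto)
qed

lemma shift_sym: "shift F s t x x' z z' \<Longrightarrow> shift F t s z z' x x'"
  unfolding shift_def insert_commute[of s t] by blast

lemma shift_rev: "shift F s t x x' z z' \<Longrightarrow> shift F s t x' x z' z"
  unfolding shift_def using sym by meson

lemma shift_refl:
  assumes "shift F s t x x' z z'"
  shows "sim (F - {s}) x x" "sim (F - {s}) x' x'" "sim (F - {t}) z z" "sim (F - {t}) z' z'"
  using assms refl unfolding shift_def by meson+

lemma shift_relabel:
  assumes "shift F s t x x' z z'" and g: "inj_on g F'" "g ` F' = F"
    and st: "s' \<in> F'" "t' \<in> F'" "g s' = s" "g t' = t"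
  shows "shift F' s' t' (x \<circ> g) (x' \<circ> g) (z \<circ> g) (z' \<circ> g)"
proof -
  obtain p p' where p: "sim F p p" "sim F p' p'" "sim (F - {s}) p x" "sim (F - {t}) p z"
     "sim (F - {s}) p' x'" "sim (F - {t}) p' z'" "\<And>u. u\<in>F - {s, t} \<Longrightarrow> sim (F - {u}) p p'"
    using assms(1) unfolding shift_def by blast
  have im: "inj_on g (F' - {r})" "g ` (F' - {r}) \<subseteq> F - {g r}" if "r \<in> F'" for r
    using g that by (auto simp: inj_on_def)
  show ?thesis
  proof (rule shiftI)
    fix u assume u: "u \<in> F' - {s', t'}"
    hence "g u \<in> F - {s, t}" using g st by (auto simp: inj_on_def)
    from relabel[OF p(7)[OF this] im] show "sim (F' - {u}) (p \<circ> g) (p' \<circ> g)" using u by simp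
  next
    have g': "g ` F' \<subseteq> F" using g by simp
    show "sim F' (p \<circ> g) (p \<circ> g)" "sim F' (p' \<circ> g) (p' \<circ> g)"
      using relabel[OF p(1) g(1) g'] relabel[OF p(2) g(1) g'] by auto
    show "sim (F' - {s'}) (p \<circ> g) (x \<circ> g)" "sim (F' - {s'}) (p' \<circ> g) (x' \<circ> g)"
      using relabel[OF p(3) im(1)] relabel[OF p(5) im(1)] im(2)[OF st(1)] st by auto
    show "sim (F' - {t'}) (p \<circ> g) (z \<circ> g)" "sim (F' - {t'}) (p' \<circ> g) (z' \<circ> g)"
      using relabel[OF p(4) im(1)] relabel[OF p(6) im(1)] im(2)[OF st(2)] st by auto
  qed
qed

lemma shift_ex:
  assumes F: "card F = Suc n" "s \<in> F" "t \<in> F" "s \<noteq> t"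
    and x: "sim (F - {s}) x x" "sim (F - {s}) x' x'" "sim (F - {t}) z z"
  shows "\<exists>z'. shift F s t x x' z z'"
proof -
  obtain u where u: "u \<in> F - {s, t}" using ex_fourth[OF F(1), of s t t] by auto
  obtain e where e: "sim F e e"
    using free[of F s "{}" "\<lambda>_. undefined"] F by (auto simp: card_ge_0_finite)
  obtain p where p: "sim F p p" "sim (F - {s}) p x" "sim (F - {t}) p z"
    using ex_point[of F s t u x z e] F u x mono[OF e, of "F - {u}"] by auto
  obtain q where q: "sim F q q" "sim (F - {s}) q x'" "\<And>r. r\<in>F - {s, t} \<Longrightarrow> sim (F - {r}) p q"
    using ex_change[OF F p(1) x(2)] by blast
  have "shift F s t x x' z q"
    by (rule shiftI[of F p q]) (use p q mono[OF q(1)] in auto)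
  thus ?thesis by blast
qed

text \<open>Additively, dx + dz = 0 and dz + dw = 0 give dx = dw, hence the reversed order of
  \<open>w\<close> and \<open>w'\<close>. Concretely, a point \<open>p\<close> with facets
  \<open>x\<close>, \<open>z\<close>, \<open>w\<close> is changed to \<open>q\<close> along
  \<open>s\<close>, \<open>t\<close> and to \<open>k\<close> along \<open>t\<close>,
  \<open>u\<close>; then \<open>k\<close> and \<open>q\<close> agree on every facet except those
  opposite \<open>s\<close> and \<open>u\<close>.\<close>

lemma shift_trans_rev:
  assumes F: "card F = Suc n" "s \<in> F" "t \<in> F" "u \<in> F" and stu: "s \<noteq> t" "s \<noteq> u" "t \<noteq> u"
    and xz: "shift F s t x x' z z'" and zw: "shift F t u z z' w w'"
  shows "shift F s u x x' w' w"
proof -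
  obtain p where p: "sim F p p" "sim (F - {s}) p x" "sim (F - {t}) p z" "sim (F - {u}) p w"
    using ex_point[OF F stu, of x z w] shift_refl[OF xz] shift_refl[OF zw] by blast
  obtain q where q: "sim F q q" "sim (F - {s}) q x'" "\<And>r. r\<in>F - {s, t} \<Longrightarrow> sim (F - {r}) p q"
    using ex_change[of F s t p x'] F stu p(1) shift_refl[OF xz] by blast
  obtain k where k: "sim F k k" "sim (F - {t}) k z'" "\<And>r. r\<in>F - {t, u} \<Longrightarrow> sim (F - {r}) p k"
    using ex_change[of F t u p z'] F stu p(1) shift_refl[OF xz] by blast
  have "shift F s t x x' z q"
    by (rule shiftI[of F p q]) (use p q mono[OF q(1)] in auto)
  hence qz: "sim (F - {t}) q z'"
    using shift_unique[of F s t x x' z q x x' z z'] F stu xz shift_refl[OF xz] by blast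
  have "shift F t u z z' w k"
    by (rule shiftI[of F p k]) (use p k mono[OF k(1)] in auto)
  hence ow: "sim (F - {u}) k w'"
    using shift_unique[of F t u z z' w k z z' w w'] F stu zw shift_refl[OF zw] by blast
  show ?thesis
  proof (rule shiftI[of F k q])
    show "sim (F - {s}) k x" using trans[OF sym[OF k(3)] p(2)] F stu by simp
    show "sim (F - {u}) q w" using trans[OF sym[OF q(3)] p(4)] F stu by simp
    fix r assume r: "r \<in> F - {s, u}"
    show "sim (F - {r}) k q"
    proof (cases "r = t")
      case True
      thus ?thesis using trans[OF k(2) sym[OF qz]] by simp
    next
      case False
      thus ?thesis using trans[OF sym[OF k(3)] q(3)] r by simp
    qed
  qed (use k q ow in auto)
qed

text \<open>The tuples \<open>x\<close>, \<open>z\<close>, \<open>w\<close> live on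
  \<open>H - {a, b}\<close>, \<open>H - {a, c}\<close>, \<open>H - {b, c}\<close>, which lie in no
  common \<open>n + 1\<close> points of \<open>H\<close>. One change from \<open>m\<close> to
  \<open>m'\<close> moves all three at once, and uniqueness identifies the new values. Hence there
  is no reversal, unlike in \<open>shift_trans_rev\<close>.\<close>

lemma shift_trans:
  assumes H: "card H = Suc (Suc n)" "{a, b, c} \<subseteq> H" and abc: "a \<noteq> b" "a \<noteq> c" "b \<noteq> c"
    and xz: "shift (H - {a}) b c x x' z z'" and xw: "shift (H - {b}) a c x x' w w'"
  shows "shift (H - {c}) a b z z' w w'"
proof -
  have fin: "finite H" using H by (simp add: card_ge_0_finite)
  have cd: "card (H - {i}) = Suc n" if "i \<in> H" for i
    using H that by (simp add: card_Diff_singleton fin)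
  have e: "H - {i} - {j} = H - {i, j}" for i j by auto
  have c: "H - {b, a} = H - {a, b}" "H - {c, a} = H - {a, c}" "H - {c, b} = H - {b, c}" by auto
  note R = shift_refl[OF xz, unfolded e] shift_refl[OF xw, unfolded e c]
  obtain d where d: "d \<in> H - {a, b, c}"
    using ex_fourth[OF cd[of a], of a b c] H by auto
  define B where "B S = (if a \<notin> S \<and> b \<notin> S then x else if a \<notin> S then z else w)" for S :: "nat set"
  have B: "B (H - {a, b}) = x" "B (H - {a, c}) = z" "B (H - {b, c}) = w"
    using H abc by (auto simp: B_def)
  have "\<exists>m. sim H m m \<and> (\<forall>S\<in>{H - {a, b}, H - {a, c}, H - {b, c}}. sim S m (B S))"
  proof (rule free[OF fin])
    show "d \<in> H" using d by simp
    fix S assume S: "S \<in> {H - {a, b}, H - {a, c}, H - {b, c}}"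
    hence "sim S (B S) (B S)" using B R by auto
    moreover have "card (H - {i, j}) = n" if "{i, j} \<subseteq> H" "i \<noteq> j" for i j
      using that H by (simp add: card_Diff_subset)
    ultimately show "S \<subseteq> H \<and> d \<in> S \<and> card S = n \<and> sim S (B S) (B S)"
      using S d H abc by auto
  qed
  then obtain m where m: "sim H m m" "sim (H - {a, b}) m x" "sim (H - {a, c}) m z" "sim (H - {b, c}) m w"
    using B by auto
  obtain p where p: "sim (H - {a}) p p" "sim (H - {a} - {b}) p x'"
      "\<And>r. r\<in>H - {a} - {b, c} \<Longrightarrow> sim (H - {a} - {r}) m p"
    using ex_change[OF cd, of a b c m x'] H abc mono[OF m(1)] R unfolding e by auto
  have p': "sim (H - {a, r}) m p" if "r \<in> H - {a, b, c}" for r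
    using p(3)[of r] that unfolding e by auto
  obtain m' where m': "sim H m' m'" "sim (H - {a}) m' p" "\<And>i. i \<in> H - {a, b, c} \<Longrightarrow> sim (H - {i}) m m'"
    using lift_change[OF H abc m(1) p(1) p'] by blast
  have sub: "sim (H - {i} - {j}) m m'" if "j \<in> H - {a, b, c}" for i j
    by (rule mono[OF m'(3)[OF that]]) auto
  have mx: "sim (H - {a} - {b}) m' x'"
    by (rule trans[OF mono[OF m'(2)] p(2)]) auto
  have M: "sim (H - {i}) m m" "sim (H - {i}) m' m'" "sim (H - {i} - {j}) m m" "sim (H - {i} - {j}) m' m'" for i j
    by (rule mono[OF m(1)], blast, rule mono[OF m'(1)], blast, rule mono[OF m(1)], blast, rule mono[OF m'(1)], blast)
  have "shift (H - {a}) b c x x' z m'"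
    by (rule shiftI[OF M(1,2)]) (use m mx M sub e c in auto)
  hence z: "sim (H - {a} - {c}) m' z'"
    using shift_unique[OF cd, of a b c x x' z m' x x' z z'] H abc xz R e c by auto
  have "shift (H - {b}) a c x x' w m'"
    by (rule shiftI[OF M(1,2)]) (use m mx M sub e c in auto)
  hence w: "sim (H - {b} - {c}) m' w'"
    using shift_unique[OF cd, of b a c x x' w m' x x' w w'] H abc xw R e c by auto
  show ?thesis
    by (rule shiftI[OF M(1,2)]) (use m z w M sub e c in auto)
qed

section \<open>The sign of a permutation of the coordinates\<close>

text \<open>The reversals from two uses of \<open>shift_trans_rev\<close> cancel.\<close>

lemma shift_switch_aux:
  assumes F: "card F = Suc n" "a \<in> F" "i \<in> F" "t \<in> F" "a \<noteq> i" "a \<noteq> t" "i \<noteq> t"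
    and x: "shift F a i x x' w w'" and y: "shift F a i y y' w w'" and t: "shift F a t x x' v v'"
  shows "shift F a t y y' v v'"
proof -
  have "shift F i t w w' v' v"
    by (rule shift_trans_rev[OF F(1) F(3) F(2) F(4) _ _ _ shift_sym[OF x] t]) (use F in auto)
  from shift_trans_rev[OF F(1) F(2) F(3) F(4) _ _ _ y this] show ?thesis using F by auto
qed

text \<open>Two changes at \<open>a\<close> with one common compensation have all compensations in
  common, so they may be regarded as equal. If \<open>i = t\<close>, the comparison takes a detour
  through a further coordinate \<open>u\<close>.\<close>

lemma shift_switch:
  assumes F: "card F = Suc n" "a \<in> F" "i \<in> F" "t \<in> F" "a \<noteq> i" "a \<noteq> t"
    and x: "shift F a i x x' w w'" and y: "shift F a i y y' w w'" and t: "shift F a t x x' v v'"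
  shows "shift F a t y y' v v'"
proof (cases "i = t")
  case False
  thus ?thesis using shift_switch_aux[OF F(1-6) _ x y t] by simp
next
  case True
  obtain u where u: "u \<in> F - {a, i}" using ex_fourth[OF F(1), of a i i] by auto
  obtain e where e: "sim F e e"
    using free[of F i "{}" "\<lambda>_. undefined"] F by (auto simp: card_ge_0_finite)
  obtain q' where q: "shift F a u x x' e q'"
    using shift_ex[of F a u x x' e] F u shift_refl[OF x] mono[OF e] by auto
  have "shift F a u y y' e q'"
    using shift_switch_aux[OF F(1-3) _ F(5) _ _ x y q] u by auto
  from shift_switch_aux[OF F(1,2) _ F(4) _ F(6) _ q this t] u True show ?thesis by auto
qed

text \<open>Relabelling two points by a transposition reverses a shift: transport the shift to an
  \<^term>\<open>n\<close>-set that avoids both points, where the transposition does nothing.  Of the three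
  transports involved, exactly one goes round three \<^term>\<open>n\<close>-sets inside a common
  \<^term>\<open>Suc n\<close>-set and so costs a sign.\<close>

lemma shift_transpose:
  assumes F: "card F = Suc n" "a \<in> F" "i \<in> F" "j \<in> F" "t \<in> F" "a \<noteq> i" "a \<noteq> j" "a \<noteq> t" "i \<noteq> j"
    and x: "shift F a t x x' w w'"
  shows "shift F a t (x \<circ> transpose i j) (x' \<circ> transpose i j) w' w"
proof -
  let ?g = "transpose i j"
  have fin: "finite F" using F by (simp add: card_ge_0_finite)
  obtain b where b: "b \<notin> F" using ex_new_if_finite[OF infinite_UNIV_nat fin] by blast
  let ?H = "insert b F"
  have H: "card ?H = Suc (Suc n)" using b fin F by simp
  have cd: "card (?H - {r}) = Suc n" if "r \<in> ?H" for r
    using H that fin by (simp add: card_Diff_singleton)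
  obtain e where e: "sim ?H e e"
    using free[of ?H b "{}" "\<lambda>_. undefined"] fin by auto
  note e' = mono[OF e]
  note xr = shift_refl[OF x]
  obtain z' where z: "shift F a j x x' e z'"
    using shift_ex[of F a j x x' e] F xr e'[of "F - {j}"] by auto
  note zr = shift_refl[OF z]
  have s: "?H - {j} - {b} = F - {j}" "?H - {i} - {b} = F - {i}" using b F by auto
  obtain v' where v: "shift (?H - {j}) b i e z' e v'"
    using shift_ex[of "?H - {j}" b i e z' e] cd F b zr e'[of "?H - {j} - {i}"] unfolding s by auto
  have g: "inj_on ?g T" for T by (rule inj_on_transpose)
  have xg: "shift F a i (x \<circ> ?g) (x' \<circ> ?g) (e \<circ> ?g) (z' \<circ> ?g)"
    by (rule shift_relabel[OF z g]) (use F in \<open>auto simp: image_iff transpose_def\<close>)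
  have vg: "shift (?H - {i}) b j (e \<circ> ?g) (z' \<circ> ?g) (e \<circ> ?g) (v' \<circ> ?g)"
    by (rule shift_relabel[OF v g]) (use F b in \<open>auto simp: image_iff transpose_def\<close>)
  have ce: "sim (?H - {i} - {j}) y (y \<circ> ?g)" if "sim (?H - {j} - {i}) y y" for y
  proof (rule cong)
    show "sim (?H - {i} - {j}) y y" by (rule mono[OF that]) auto
  qed (auto simp: transpose_def)
  note vr = shift_refl[OF v] shift_refl[OF vg]
  have vg': "shift (?H - {i}) b j (e \<circ> ?g) (z' \<circ> ?g) e v'"
    by (rule shift_cong[OF vg vr(5,6) sym[OF ce] sym[OF ce]]) (rule vr)+
  \<comment> \<open>The change of \<open>e\<close> to \<open>v'\<close> on the set without
    \<open>i\<close> and \<open>j\<close> links the original to its relabelled copy. This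
    composition runs through three different faces of \<open>?H\<close> and costs no sign.\<close>
  have "shift (?H - {b}) j i e z' (e \<circ> ?g) (z' \<circ> ?g)"
    by (rule shift_trans[OF H _ _ _ _ shift_sym[OF v] shift_sym[OF vg']]) (use F b in auto)
  hence "shift F j i e z' (e \<circ> ?g) (z' \<circ> ?g)" using b by simp
  \<comment> \<open>Here the path from \<open>a\<close> over \<open>j\<close> to \<open>i\<close>
    stays inside \<open>F\<close>, which produces the sign.\<close>
  from shift_trans_rev[OF F(1,2,4,3) _ _ _ z this]
  have "shift F a i x x' (z' \<circ> ?g) (e \<circ> ?g)" using F by auto
  from shift_switch[OF F(1,2,3,5,6,8) shift_rev[OF this] xg shift_rev[OF x]] show ?thesis .
qed

text \<open>Induction over a factorisation into transpositions, each of which exchanges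
  \<open>w\<close> and \<open>w'\<close> by \<open>shift_transpose\<close>.\<close>

lemma shift_permutes:
  assumes "p permutes F - {a}" and F: "card F = Suc n" "a \<in> F" "t \<in> F" "a \<noteq> t"
    and "shift F a t x x' w w'"
  shows "shift F a t (x \<circ> p) (x' \<circ> p) (if evenperm p then w else w') (if evenperm p then w' else w)"
proof -
  have fin: "finite (F - {a})" using F by (simp add: card_ge_0_finite)
  show ?thesis using assms(1) fin assms(6)
  proof (induction arbitrary: x x' w w' rule: permutes_induct)
    case id
    thus ?case by (simp add: evenperm_id)
  next
    case (swap i j p)
    have "permutation p" using permutes_imp_permutation[OF fin swap.hyps(4)] .
    hence ev: "evenperm (transpose i j \<circ> p) \<longleftrightarrow> \<not> evenperm p"
      using swap.hyps(3) by (simp add: evenperm_comp permutation_swap_id evenperm_swap)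
    have "shift F a t (x \<circ> transpose i j) (x' \<circ> transpose i j) w' w"
      by (rule shift_transpose[OF F(1,2) _ _ F(3) _ _ F(4) _ swap.prems]) (use swap.hyps in auto)
    from swap.IH[OF this] show ?case
      unfolding ev comp_assoc by (cases "evenperm p") (simp_all only: simp_thms if_True if_False)
  qed
qed

section \<open>An orbit fixed by an \<open>n\<close>-cycle, and the contradiction\<close>

definition rot :: "nat \<Rightarrow> nat" where
  "rot i = (if i < n then Suc i mod n else i)"

lemma rot_permutes: "rot permutes {..<n}"
proof (rule bij_imp_permutes)
  have "inj_on rot {..<n}"
    by (auto simp: inj_on_def rot_def mod_Suc split: if_splits)
  moreover have "rot ` {..<n} \<subseteq> {..<n}" using n_ge_4 by (auto simp: rot_def)
  ultimately show "bij_betw rot {..<n} {..<n}"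
    by (simp add: bij_betw_def endo_inj_surj)
qed (simp add: rot_def)

lemma rot_funpow: "i < n \<Longrightarrow> (rot ^^ m) i = (i + m) mod n"
  by (induction m) (auto simp: rot_def mod_Suc_eq)

text \<open>The base point \<open>n\<close> is fixed by \<open>rot\<close>, while the facets
  \<open>{..n} - {j}\<close> with \<open>j < n\<close> are permuted in a single cycle. So a value on
  one facet can be spread over all of them by powers of \<open>rot\<close>, consistently because the
  \<open>n\<close>-th power is the identity.\<close>

lemma ex_rot_invariant: "\<exists>x. sim {..n} (x \<circ> rot) x"
proof -
  obtain e where e: "sim {..n} e e"
    using free[of "{..n}" n "{}" "\<lambda>_. undefined"] by auto
  have n0: "0 < n" using n_ge_4 by simp
  have rot: "inj_on rot T" "rot ` {..n} \<subseteq> {..n}" for T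
  proof -
    show "inj_on rot T" using permutes_inj_on[OF rot_permutes] .
    show "rot ` {..n} \<subseteq> {..n}"
      using less_imp_le[OF mod_less_divisor[OF n0]] by (auto simp: rot_def)
  qed
  \<comment> \<open>\<open>r j\<close> stands for the power of \<open>rot\<close> with exponent
    \<open>- j\<close>, taken modulo \<open>n\<close>.\<close>
  define r where "r j = rot ^^ (n - j)" for j
  have r: "inj_on (r j) {..n}" "r j ` {..n} \<subseteq> {..n}" for j
  proof -
    show "inj_on (r j) {..n}"
      using inj_on_subset[OF inj_fn[OF permutes_inj[OF rot_permutes]] subset_UNIV] by (simp add: r_def)
    have "(rot ^^ m) ` {..n} \<subseteq> {..n}" for m
      using rot(2) by (induction m) auto
    thus "r j ` {..n} \<subseteq> {..n}" by (simp add: r_def)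
  qed
  define B where "B S = e \<circ> r (SOME j. j < n \<and> j \<notin> S)" for S
  have B: "B ({..n} - {j}) = e \<circ> r j" if "j < n" for j
  proof -
    have "(SOME i. i < n \<and> i \<notin> {..n} - {j}) = j" by (rule some_equality) (use that in auto)
    thus ?thesis by (simp add: B_def)
  qed
  have "\<exists>x. sim {..n} x x \<and> (\<forall>S\<in>{{..n} - {j} | j. j < n}. sim S x (B S))"
  proof (rule free[of _ n])
    fix S assume "S \<in> {{..n} - {j} | j. j < n}"
    then obtain j where j: "S = {..n} - {j}" "j < n" by blast
    have "sim {..n} (e \<circ> r j) (e \<circ> r j)" by (rule relabel[OF e r])
    hence "sim S (B S) (B S)" unfolding j(1) B[OF j(2)] by (rule mono) auto
    thus "S \<subseteq> {..n} \<and> n \<in> S \<and> card S = n \<and> sim S (B S) (B S)"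
      using j by (auto simp: card_Diff_singleton)
  qed auto
  then obtain x where x: "sim {..n} x x"
    and xB: "\<And>S. S \<in> {{..n} - {j} | j. j < n} \<Longrightarrow> sim S x (B S)"
    by blast
  have xr: "sim ({..n} - {j}) x (e \<circ> r j)" if "j < n" for j
    unfolding B[OF that, symmetric] by (rule xB) (use that in blast)
  have "sim {..n} (x \<circ> rot) x"
  proof (rule determined_Suc[of _ n])
    fix j assume "j \<in> {..n}" "j \<noteq> n"
    hence j: "j < n" by simp
    let ?j = "rot j"
    have j': "?j < n" using j n0 by (simp add: rot_def)
    have "sim ({..n} - {j}) (x \<circ> rot) (e \<circ> r ?j \<circ> rot)"
      by (rule relabel[OF xr[OF j'] rot(1)])
        (use rot(2) permutes_inj[OF rot_permutes, THEN injD] in blast)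
    moreover have "sim ({..n} - {j}) (e \<circ> r ?j \<circ> rot) (e \<circ> r j)"
    proof (rule cong[OF refl(2)[OF calculation]])
      fix i assume i: "i \<in> {..n} - {j}"
      have "r ?j (rot i) = r j i"
      proof (cases "i < n")
        case True
        show ?thesis
        proof (cases "Suc j = n")
          case True
          hence j0: "n - j = 1" "?j = 0" using j by (auto simp: rot_def)
          \<comment> \<open>Closing the cycle: from \<open>j = n - 1\<close> to \<open>0\<close> the
            exponent jumps from \<open>1\<close> to \<open>n\<close>.\<close>
          have "(rot ^^ n) (rot i) = rot i"
            using \<open>i < n\<close> n0 by (subst rot_funpow) (auto simp: rot_def)
          thus ?thesis using j0 by (simp add: r_def)
        next
          case False
          hence "?j = Suc j" using j by (simp add: rot_def)
          hence "n - j = Suc (n - ?j)" using j by simp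
          thus ?thesis unfolding r_def by (simp add: funpow_swap1)
        qed
      next
        case False
        hence "rot i = i" "(rot ^^ m) i = i" for m by (induction m) (auto simp: rot_def)
        thus ?thesis by (simp add: r_def)
      qed
      thus "(e \<circ> r ?j \<circ> rot) i = (e \<circ> r j) i" by simp
    qed
    ultimately have "sim ({..n} - {j}) (x \<circ> rot) (e \<circ> r j)" by (rule trans)
    thus "sim ({..n} - {j}) (x \<circ> rot) x" using trans sym[OF xr[OF j]] by blast
  qed (use relabel[OF x rot] x in auto)
  thus ?thesis by blast
qed

theorem inconsistent: False
proof -
  obtain x where "sim {..n} (x \<circ> rot) x" using ex_rot_invariant by blast
  hence xr: "sim {..<n} (x \<circ> rot) x" by (rule mono) auto
  have p: "inj_on p {..<n}" "p ` {..<n} \<subseteq> {..<n}" if "p permutes {..<n}" for p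
    using permutes_inj_on[OF that] permutes_image[OF that] by auto
  \<comment> \<open>Chosen so that \<open>?h \<circ> ?g \<circ> ?h \<circ> ?d\<close> fixes the
    index \<open>1\<close> without being the identity.\<close>
  let ?h = "transpose 1 (2::nat)" and ?g = "rot \<circ> rot" and ?d = "inv_into UNIV rot" and ?F = "{..n}"
  have h: "?h permutes {..<n}" by (rule permutes_swap_id) (use n_ge_4 in auto)
  have g: "?g permutes {..<n}" by (rule permutes_compose[OF rot_permutes rot_permutes])
  have F: "?F - {n} = {..<n}" by auto
  have even: "evenperm ?g"
    using permutes_imp_permutation[OF _ rot_permutes] by (simp add: evenperm_comp)
  have xg: "sim {..<n} (x \<circ> ?g) x"
    using trans[OF relabel[OF xr p[OF rot_permutes]] xr] by (simp add: comp_assoc)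
  have xh: "sim {..<n} (x \<circ> ?h) (x \<circ> ?h)"
    by (rule relabel[OF refl(2)[OF xr] p[OF h]])
  obtain e where e: "sim ?F e e"
    using free[of ?F n "{}" "\<lambda>_. undefined"] by auto
  have n0: "0 \<in> ?F" "n \<noteq> 0" using n_ge_4 by auto
  obtain w where w: "shift ?F n 0 x (x \<circ> ?h) e w"
    using shift_ex[of ?F n 0 x "x \<circ> ?h" e] n0 refl(2)[OF xr] xh mono[OF e] unfolding F by auto
  \<comment> \<open>As \<open>?g\<close> is even, the relabelled change has the same compensation
    \<open>e\<close> to \<open>w\<close>. Its start \<open>x \<circ> ?g\<close> is equivalent to
    \<open>x\<close>, so by uniqueness, read from coordinate \<open>0\<close> back to
    \<open>n\<close>, its end is equivalent to \<open>x \<circ> ?h\<close>.\<close>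
  have "shift ?F n 0 (x \<circ> ?g) (x \<circ> ?h \<circ> ?g) e w"
    using shift_permutes[of ?g ?F n 0, OF _ _ _ n0(1,2) w] g even unfolding F by simp
  from shift_unique[OF _ n0(1) _ _ shift_sym[OF this] shift_sym[OF w], unfolded F]
  have "sim {..<n} (x \<circ> ?h \<circ> ?g) (x \<circ> ?h)"
    using xg n0 shift_refl[OF w] by auto
  from relabel[OF this p[OF h]]
  have "sim {..<n} (x \<circ> (?h \<circ> ?g \<circ> ?h)) x" by (simp add: comp_assoc)
  from relabel[OF trans[OF this sym[OF xr]] p[OF permutes_inv[OF rot_permutes]]]
  have s: "sim {..<n} (x \<circ> (?h \<circ> ?g \<circ> ?h \<circ> ?d)) x"
    by (simp add: comp_assoc permutes_inv_o(1)[OF rot_permutes])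
  have r: "rot 0 = 1" "rot 1 = 2" "rot 2 = 3" using n_ge_4 by (auto simp: rot_def)
  have "?d 1 = 0" using r permutes_inv_eq[OF rot_permutes] by blast
  hence fix1: "(?h \<circ> ?g \<circ> ?h \<circ> ?d) 1 = 1" using r by (simp add: transpose_def)
  have "?h \<circ> ?g \<circ> ?h \<circ> ?d permutes {..<n}"
    by (intro permutes_compose h g rot_permutes permutes_inv)
  from semiregular[OF _ this _ fix1 s] have "?h \<circ> ?g \<circ> ?h \<circ> ?d = id"
    using n_ge_4 by simp
  hence "(?h \<circ> ?g \<circ> ?h \<circ> ?d) 2 = 2" by simp
  moreover have "?d 2 = 1" using r permutes_inv_eq[OF rot_permutes] by blast
  ultimately have "?h (rot 3) = 2" using r by (simp add: transpose_def)
  \<comment> \<open>The value is \<open>0\<close> for \<open>n = 4\<close> and \<open>4\<close> for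
    larger \<open>n\<close>, so never \<open>1\<close>.\<close>
  moreover have "rot 3 = 4 mod n" using n_ge_4 by (simp add: rot_def)
  hence "rot 3 \<noteq> 1" using n_ge_4 by (cases "n = 4") simp_all
  ultimately show False by (auto simp: transpose_def split: if_splits)
qed

end

section \<open>Transitive extensions of a homogeneous universal hypertournament\<close>

definition same_orbit where
  "same_orbit \<Omega> G S a b \<longleftrightarrow> inj_on a S \<and> a ` S \<subseteq> \<Omega> \<and> inj_on b S \<and> b ` S \<subseteq> \<Omega> \<and>
     (\<exists>g\<in>G. \<forall>i\<in>S. g (a i) = b i)"

text \<open>Only the permutation group of the extension is retained, not its language. The group
  laws are required pointwise on \<open>insert z M\<close>, so values elsewhere do not matter.
  \<open>universal\<close> speaks of structures on natural numbers, matching the index sets of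
  tuples.\<close>

locale transitive_extension =
  fixes k :: nat and M :: "'a set" and T :: "'a list set" and z :: 'a and G :: "('a \<Rightarrow> 'a) set"
  assumes k: "2 < k" and z: "z \<notin> M"
    and bij: "g \<in> G \<Longrightarrow> bij_betw g (insert z M) (insert z M)"
    and one: "\<exists>g\<in>G. \<forall>x\<in>insert z M. g x = x"
    and mult: "g \<in> G \<Longrightarrow> h \<in> G \<Longrightarrow> \<exists>f\<in>G. \<forall>x\<in>insert z M. f x = g (h x)"
    and inv: "g \<in> G \<Longrightarrow> \<exists>h\<in>G. \<forall>x\<in>insert z M. h (g x) = x"
    and transitive: "x \<in> insert z M \<Longrightarrow> \<exists>g\<in>G. g x = z"
    and unique: "S \<subseteq> M \<Longrightarrow> finite S \<Longrightarrow> card S = k \<Longrightarrow> \<exists>!xs. set xs = S \<and> distinct xs \<and> xs \<in> T"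
    and distinct: "xs \<in> T \<Longrightarrow> distinct xs"
    and invariant: "g \<in> G \<Longrightarrow> g z = z \<Longrightarrow> xs \<in> nlists k M \<Longrightarrow> map g xs \<in> T \<longleftrightarrow> xs \<in> T"
    and homogeneous: "finite A \<Longrightarrow> A \<subseteq> M \<Longrightarrow> inj_on h A \<Longrightarrow> h ` A \<subseteq> M \<Longrightarrow>
      (\<And>xs. xs \<in> nlists k A \<Longrightarrow> map h xs \<in> T \<longleftrightarrow> xs \<in> T) \<Longrightarrow> \<exists>g\<in>G. g z = z \<and> (\<forall>x\<in>A. g x = h x)"
    and universal: "finite U \<Longrightarrow> R \<subseteq> nlists k U \<Longrightarrow> (\<And>xs. xs \<in> R \<Longrightarrow> distinct xs) \<Longrightarrow>
      (\<And>S. S \<subseteq> U \<Longrightarrow> card S = k \<Longrightarrow> \<exists>!xs. set xs = S \<and> distinct xs \<and> xs \<in> R) \<Longrightarrow>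
      \<exists>h :: nat \<Rightarrow> 'a. inj_on h U \<and> h ` U \<subseteq> M \<and> (\<forall>xs\<in>nlists k U. map h xs \<in> T \<longleftrightarrow> xs \<in> R)"
begin

abbreviation \<Omega> where "\<Omega> \<equiv> insert z M"
abbreviation sim :: "nat set \<Rightarrow> (nat \<Rightarrow> 'a) \<Rightarrow> (nat \<Rightarrow> 'a) \<Rightarrow> bool" where "sim \<equiv> same_orbit \<Omega> G"

lemma sim_cong:
  assumes "inj_on a S" "a ` S \<subseteq> \<Omega>" "\<And>i. i \<in> S \<Longrightarrow> a i = b i"
  shows "sim S a b"
proof -
  obtain g where g: "g \<in> G" "\<And>x. x \<in> \<Omega> \<Longrightarrow> g x = x" using one by blast
  have "inj_on b S" using assms(1) inj_on_cong[of S a b] assms(3) by simp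
  moreover have "b ` S = a ` S" using assms(3) by (simp cong: image_cong)
  moreover have "\<forall>i\<in>S. g (a i) = b i" using g(2) assms(2,3) by (simp add: image_subset_iff)
  ultimately show ?thesis using assms(1,2) g(1) unfolding same_orbit_def by auto
qed

lemma simE:
  assumes "sim S a b"
  obtains g where "inj_on a S" "a ` S \<subseteq> \<Omega>" "inj_on b S" "b ` S \<subseteq> \<Omega>" "g \<in> G"
    "\<And>i. i \<in> S \<Longrightarrow> g (a i) = b i"
  using assms unfolding same_orbit_def by blast

lemma simI:
  assumes "inj_on a S" "a ` S \<subseteq> \<Omega>" "inj_on b S" "b ` S \<subseteq> \<Omega>" "g \<in> G"
    "\<And>i. i \<in> S \<Longrightarrow> g (a i) = b i"
  shows "sim S a b"
  using assms unfolding same_orbit_def by blast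

lemma simD:
  assumes "sim S a b"
  shows "inj_on a S" "a ` S \<subseteq> \<Omega>" "inj_on b S" "b ` S \<subseteq> \<Omega>"
  using assms unfolding same_orbit_def by simp_all

lemma sim_sym:
  assumes "sim S a b" shows "sim S b a"
proof -
  obtain g where g: "inj_on a S" "a ` S \<subseteq> \<Omega>" "inj_on b S" "b ` S \<subseteq> \<Omega>" "g \<in> G"
    "\<And>i. i \<in> S \<Longrightarrow> g (a i) = b i" using simE[OF assms] by metis
  obtain h where h: "h \<in> G" "\<forall>x\<in>\<Omega>. h (g x) = x" using inv[OF g(5)] by blast
  show ?thesis
  proof (rule simI[OF g(3,4,1,2) h(1)])
    fix i assume i: "i \<in> S"
    have "h (g (a i)) = a i" using h(2) g(2) i by blast
    thus "h (b i) = a i" using g(6)[OF i] by simp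
  qed
qed

lemma sim_trans:
  assumes "sim S a b" "sim S b c" shows "sim S a c"
proof -
  obtain g where g: "inj_on a S" "a ` S \<subseteq> \<Omega>" "g \<in> G" "\<And>i. i \<in> S \<Longrightarrow> g (a i) = b i"
    using simE[OF assms(1)] by metis
  obtain h where h: "inj_on c S" "c ` S \<subseteq> \<Omega>" "h \<in> G" "\<And>i. i \<in> S \<Longrightarrow> h (b i) = c i"
    using simE[OF assms(2)] by metis
  obtain f where f: "f \<in> G" "\<forall>x\<in>\<Omega>. f x = h (g x)" using mult[OF h(3) g(3)] by blast
  show ?thesis
  proof (rule simI[OF g(1,2) h(1,2) f(1)])
    fix i assume i: "i \<in> S"
    hence "f (a i) = h (g (a i))" using f(2) g(2) by blast
    thus "f (a i) = c i" using g(4)[OF i] h(4)[OF i] by simp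
  qed
qed

lemma sim_relabel:
  assumes "sim S a b" "inj_on g S'" "g ` S' \<subseteq> S" shows "sim S' (a \<circ> g) (b \<circ> g)"
proof -
  have "inj_on (c \<circ> g) S' \<and> (c \<circ> g) ` S' \<subseteq> \<Omega>" if "inj_on c S" "c ` S \<subseteq> \<Omega>" for c :: "nat \<Rightarrow> 'a"
    using comp_inj_on[OF assms(2) inj_on_subset[OF that(1) assms(3)]] assms(3) that(2) by auto
  moreover obtain f where f: "inj_on a S" "a ` S \<subseteq> \<Omega>" "inj_on b S" "b ` S \<subseteq> \<Omega>" "f \<in> G"
    "\<And>i. i \<in> S \<Longrightarrow> f (a i) = b i" using simE[OF assms(1)] by metis
  moreover have "f ((a \<circ> g) i) = (b \<circ> g) i" if "i \<in> S'" for i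
    using f(6)[of "g i"] assms(3) that by (simp add: image_subset_iff)
  ultimately show ?thesis using simI[of "a \<circ> g" S' "b \<circ> g" f] by simp
qed

section \<open>Tuples with one coordinate moved to the new point\<close>

text \<open>This is where transitivity enters. Moving coordinate \<open>i\<close> to
  \<open>z\<close> reduces orbits of \<open>G\<close> to orbits of the stabiliser of
  \<open>z\<close>, which are governed by \<open>T\<close>.\<close>

lemma ex_normalize:
  assumes "sim S a a" "i \<in> S" shows "\<exists>b. sim S a b \<and> b i = z"
proof -
  have a: "inj_on a S" "a ` S \<subseteq> \<Omega>" using simD[OF assms(1)] by simp_all
  have "a i \<in> \<Omega>" using a(2) assms(2) by (simp add: image_subset_iff)
  then obtain g where g: "g \<in> G" "g (a i) = z" using transitive by blast
  have b: "inj_on g \<Omega>" "g ` \<Omega> = \<Omega>" using bij[OF g(1)] by (auto simp: bij_betw_def)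
  have "inj_on (g \<circ> a) S" using comp_inj_on[OF a(1) inj_on_subset[OF b(1) a(2)]] .
  moreover have "(g \<circ> a) ` S \<subseteq> \<Omega>"
    unfolding image_comp[symmetric] using image_mono[OF a(2), of g] b(2) by (rule subset_trans[OF _ equalityD1])
  ultimately have "sim S a (g \<circ> a)" by (rule simI[OF a _ _ g(1)]) simp
  thus ?thesis using g by auto
qed

lemma normalized_in:
  assumes "sim S a a" "i \<in> S" "a i = z" "j \<in> S" "j \<noteq> i" shows "a j \<in> M"
proof -
  have a: "inj_on a S" "a ` S \<subseteq> \<Omega>" using simD[OF assms(1)] by simp_all
  have "a j \<noteq> a i" using inj_onD[OF a(1) _ assms(4,2)] assms(5) by blast
  moreover have "a j \<in> \<Omega>" using a(2) assms(4) by blast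
  ultimately show ?thesis using assms(3) by simp
qed

text \<open>The map sending \<open>a j\<close> to \<open>b j\<close> for \<open>j \<noteq> i\<close>
  is a finite partial isomorphism, so homogeneity extends it to an element fixing \<open>z\<close>.
  Lists with repetitions satisfy \<open>T\<close> on neither side, so only distinct ones are
  compared.\<close>

lemma simI_normalized:
  assumes S: "finite S" "i \<in> S" and a: "sim S a a" "a i = z" and b: "sim S b b" "b i = z"
    and T: "\<And>xs. xs \<in> nlists k (S - {i}) \<Longrightarrow> distinct xs \<Longrightarrow> map a xs \<in> T \<longleftrightarrow> map b xs \<in> T"
  shows "sim S a b"
proof -
  have inj: "inj_on a (S - {i})" "inj_on b (S - {i})"
    using inj_on_subset[OF simD(1)[OF a(1)] Diff_subset] inj_on_subset[OF simD(1)[OF b(1)] Diff_subset] .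
  let ?A = "a ` (S - {i})"
  let ?f = "inv_into (S - {i}) a"
  have im: "?A \<subseteq> M" "b ` (S - {i}) \<subseteq> M"
    using normalized_in[OF a(1) S(2) a(2)] normalized_in[OF b(1) S(2) b(2)] by (simp_all add: image_subset_iff)
  have f: "?f x \<in> S - {i}" "a (?f x) = x" if "x \<in> ?A" for x
    using inv_into_into[OF that] f_inv_into_f[OF that] by simp_all
  have "\<exists>g\<in>G. g z = z \<and> (\<forall>x\<in>?A. g x = (b \<circ> ?f) x)"
  proof (rule homogeneous)
    show "inj_on (b \<circ> ?f) ?A"
      by (rule comp_inj_on[OF inj_on_inv_into[OF order.refl] inj_on_subset[OF inj(2)]])
        (rule image_subsetI, rule f(1))
    show "(b \<circ> ?f) ` ?A \<subseteq> M"
      unfolding image_comp[symmetric]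
      by (rule subset_trans[OF image_mono im(2)], rule image_subsetI, rule f(1))
    fix xs assume xs: "xs \<in> nlists k ?A"
    have sxs: "set xs \<subseteq> ?A" "length xs = k" using xs by (simp_all add: nlists_def)
    have e: "map a (map ?f xs) = xs"
      unfolding map_map by (rule map_idI) (simp only: o_apply f(2)[OF subsetD[OF sxs(1)]])
    have sf: "set (map ?f xs) \<subseteq> S - {i}"
      unfolding set_map by (rule image_subsetI, rule f(1), rule subsetD[OF sxs(1)])
    have mem: "map ?f xs \<in> nlists k (S - {i})" using sf sxs(2) by (simp add: nlists_def)
    show "map (b \<circ> ?f) xs \<in> T \<longleftrightarrow> xs \<in> T"
    proof (cases "distinct xs")
      case True
      have "distinct (map ?f xs)" using True e distinct_map[of a "map ?f xs"] by simp
      from T[OF mem this] show ?thesis unfolding e by simp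
    next
      case False
      have "distinct (map b (map ?f xs)) \<longleftrightarrow> distinct (map a (map ?f xs))"
        unfolding distinct_map[of a] distinct_map[of b]
        using inj_on_subset[OF inj(1) sf] inj_on_subset[OF inj(2) sf] by blast
      hence "\<not> distinct (map (b \<circ> ?f) xs)" unfolding e using False by simp
      thus ?thesis using False distinct by blast
    qed
  qed (use S im in simp_all)
  then obtain g where "g \<in> G" "g z = z \<and> (\<forall>x\<in>?A. g x = (b \<circ> ?f) x)" by (rule bexE)
  hence g: "g \<in> G" "g z = z" "\<forall>x\<in>?A. g x = (b \<circ> ?f) x" by simp_all
  have "g (a j) = b j" if "j \<in> S" for j
  proof (cases "j = i")
    case False
    hence j: "j \<in> S - {i}" using that by simp
    show ?thesis using g(3)[rule_format, OF imageI[OF j]] inv_into_f_f[OF inj(1) j] by simp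
  qed (simp add: g(2) a(2) b(2))
  from simI[OF simD(1,2)[OF a(1)] simD(1,2)[OF b(1)] g(1) this] show ?thesis .
qed

lemma sim_normalizedD:
  assumes "sim S a b" "i \<in> S" "a i = z" "b i = z"
    and xs: "xs \<in> nlists k (S - {i})"
  shows "map a xs \<in> T \<longleftrightarrow> map b xs \<in> T"
proof -
  have a: "sim S a a" using sim_trans[OF assms(1) sim_sym[OF assms(1)]] .
  obtain g where g: "g \<in> G" "\<And>j. j \<in> S \<Longrightarrow> g (a j) = b j"
    using simE[OF assms(1)] by metis
  have "g z = z" using g(2)[OF assms(2)] assms by simp
  moreover have "map a xs \<in> nlists k M"
    using xs normalized_in[OF a assms(2,3)] by (auto simp: nlists_def)
  moreover have "map b xs = map g (map a xs)" using xs g(2) by (auto simp: nlists_def)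
  ultimately show ?thesis using invariant[OF g(1)] by metis
qed

text \<open>After normalisation the orbit is given by \<open>T\<close> on the
  \<open>k\<close>-subsets of \<open>F - {i}\<close>, and each of them together with
  \<open>i\<close> forms a set on which \<open>a\<close> and \<open>b\<close> agree by
  assumption.\<close>

lemma sim_determined:
  assumes F: "finite F" "i \<in> F" and a: "sim F a a" and b: "sim F b b"
    and ab: "\<And>S. S \<subseteq> F \<Longrightarrow> i \<in> S \<Longrightarrow> card S = Suc k \<Longrightarrow> sim S a b"
  shows "sim F a b"
proof -
  obtain a' where a': "sim F a a'" "a' i = z" using ex_normalize[OF a F(2)] by blast
  obtain b' where b': "sim F b b'" "b' i = z" using ex_normalize[OF b F(2)] by blast
  have sub: "sim S c d" if "sim F c d" "S \<subseteq> F" for S c d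
    using sim_relabel[OF that(1), of id S] that(2) by simp
  have "sim F a' b'"
  proof (rule simI_normalized[OF F])
    show "a' i = z" "b' i = z" using a' b' by simp_all
    show "sim F a' a'" "sim F b' b'" using a' b' sim_trans sim_sym by blast+
    fix xs assume xs: "xs \<in> nlists k (F - {i})" "distinct xs"
    let ?S = "insert i (set xs)"
    have S: "?S \<subseteq> F" "card ?S = Suc k"
      using xs F distinct_card[OF xs(2)] by (auto simp: nlists_def card_insert_if)
    have "sim ?S a' b'"
      using sim_trans[OF sim_trans[OF sim_sym[OF sub[OF a'(1) S(1)]] ab[OF S(1) _ S(2)]] sub[OF b'(1) S(1)]]
      by simp
    from sim_normalizedD[OF this, of i xs] show "map a' xs \<in> T \<longleftrightarrow> map b' xs \<in> T"
      using a' b' xs by (auto simp: nlists_def)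
  qed
  thus ?thesis using a'(1) b'(1) sim_trans sim_sym by blast
qed

text \<open>Different members of \<S> leave different \<open>k\<close>-sets after removal of
  \<open>i\<close>, and a hypertournament may order its \<open>k\<close>-sets independently of each
  other. So the wanted structure on \<open>F - {i}\<close> is assembled one \<open>k\<close>-set at
  a time and then realised in \<open>M\<close>.\<close>

lemma sim_free:
  assumes F: "finite F" "i \<in> F"
    and B: "\<And>S. S \<in> \<S> \<Longrightarrow> S \<subseteq> F \<and> i \<in> S \<and> card S = Suc k \<and> sim S (B S) (B S)"
  shows "\<exists>a. sim F a a \<and> (\<forall>S\<in>\<S>. sim S a (B S))"
proof -
  have "\<forall>S\<in>\<S>. \<exists>c. sim S (B S) c \<and> c i = z" using B ex_normalize by blast
  then obtain c where c: "\<And>S. S \<in> \<S> \<Longrightarrow> sim S (B S) (c S)" "\<And>S. S \<in> \<S> \<Longrightarrow> c S i = z"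
    by metis
  have cc: "sim S (c S) (c S)" if "S \<in> \<S>" for S
    using sim_trans[OF sim_sym[OF c(1)] c(1)] that by blast
  \<comment> \<open>A prescribed \<open>k\<close>-set inherits its ordering from the normalised
    tuple; the increasing ordering is an arbitrary default for the others.\<close>
  define R where "R = {xs \<in> nlists k (F - {i}). distinct xs \<and>
    (if insert i (set xs) \<in> \<S> then map (c (insert i (set xs))) xs \<in> T
     else xs = sorted_list_of_set (set xs))}"
  have "\<exists>h. inj_on h (F - {i}) \<and> h ` (F - {i}) \<subseteq> M \<and>
          (\<forall>xs\<in>nlists k (F - {i}). map h xs \<in> T \<longleftrightarrow> xs \<in> R)"
  proof (rule universal)
    fix X assume X: "X \<subseteq> F - {i}" "card X = k"
    have fX: "finite X" using X F finite_subset by blast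
    have len: "xs \<in> nlists k (F - {i})" if "set xs = X" "distinct xs" for xs
      using that X distinct_card[OF that(2)] by (auto simp: nlists_def)
    show "\<exists>!xs. set xs = X \<and> distinct xs \<and> xs \<in> R"
    proof (cases "insert i X \<in> \<S>")
      case True
      let ?c = "c (insert i X)"
      have inj: "inj_on ?c X"
        using inj_on_subset[OF simD(1)[OF cc[OF True]] subset_insertI] .
      have "?c ` X \<subseteq> M" using normalized_in[OF cc[OF True], of i] c(2)[OF True] X by auto
      moreover have "card (?c ` X) = k" using card_image[OF inj] X by simp
      ultimately have "\<exists>!ys. set ys = ?c ` X \<and> distinct ys \<and> ys \<in> T"
        using unique fX by blast
      then obtain ys where ys: "set ys = ?c ` X" "distinct ys" "ys \<in> T"
        and uq: "\<And>ys'. set ys' = ?c ` X \<Longrightarrow> distinct ys' \<Longrightarrow> ys' \<in> T \<Longrightarrow> ys' = ys" by metis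
      let ?xs = "map (inv_into X ?c) ys"
      have e: "map ?c ?xs = ys" using ys(1) unfolding map_map by (intro map_idI) (simp add: f_inv_into_f)
      have sx: "set ?xs = X" using ys(1) inj by (simp add: image_comp inv_into_image_cancel)
      have dx: "distinct ?xs" using e ys(2) by (metis distinct_map)
      show ?thesis
      proof (rule ex1I[of _ ?xs])
        show "set ?xs = X \<and> distinct ?xs \<and> ?xs \<in> R"
          unfolding R_def using sx dx len[OF sx dx] e ys(3) True by auto
        fix xs assume xs: "set xs = X \<and> distinct xs \<and> xs \<in> R"
        hence "map ?c xs \<in> T" using True by (auto simp: R_def)
        moreover have "distinct (map ?c xs)" using xs inj by (simp add: distinct_map)
        ultimately have "map ?c xs = map ?c ?xs" using uq[of "map ?c xs"] xs e by simp
        thus "xs = ?xs" using inj xs sx by (simp add: inj_on_map_eq_map del: map_map)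
      qed
    next
      case False
      have sl: "set (sorted_list_of_set X) = X" "distinct (sorted_list_of_set X)" using fX by auto
      show ?thesis
        by (rule ex1I[of _ "sorted_list_of_set X"]) (use len[OF sl] sl False in \<open>auto simp: R_def\<close>)
    qed
  qed (use F in \<open>auto simp: R_def\<close>)
  then obtain h where h: "inj_on h (F - {i})" "h ` (F - {i}) \<subseteq> M"
    "\<And>xs. xs \<in> nlists k (F - {i}) \<Longrightarrow> map h xs \<in> T \<longleftrightarrow> xs \<in> R" by blast
  define a where "a = h(i := z)"
  have "inj_on a F" "a ` F \<subseteq> \<Omega>"
    using h(1,2) z by (auto simp: a_def inj_on_def image_iff split: if_splits)
  hence aF: "sim F a a" by (rule sim_cong) simp
  have "sim S a (B S)" if S: "S \<in> \<S>" for S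
  proof -
    have "sim S a (c S)"
    proof (rule simI_normalized[of _ i])
      show "sim S a a" using sim_relabel[OF aF, of id S] B[OF S] by simp
      show "a i = z" by (simp add: a_def)
      fix xs assume xs: "xs \<in> nlists k (S - {i})" "distinct xs"
      have fS: "finite S" using B[OF S] F finite_subset by blast
      \<comment> \<open>A distinct list of length \<open>k\<close> exhausts \<open>S - {i}\<close>,
        so the value of \<open>R\<close> at \<open>xs\<close> was read off from
        \<open>c S\<close>.\<close>
      have "set xs = S - {i}"
        by (rule card_subset_eq) (use fS xs B[OF S] distinct_card[OF xs(2)] in \<open>auto simp: nlists_def card_Diff_singleton\<close>)
      hence iS: "insert i (set xs) = S" using B[OF S] by auto
      have nl: "xs \<in> nlists k (F - {i})" using xs B[OF S] by (auto simp: nlists_def)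
      have ah: "map a xs = map h xs" using xs by (auto simp: a_def nlists_def)
      have "map a xs \<in> T \<longleftrightarrow> xs \<in> R" unfolding ah by (rule h(3)[OF nl])
      also have "\<dots> \<longleftrightarrow> map (c S) xs \<in> T" using nl xs S by (simp add: R_def iS)
      finally show "map a xs \<in> T \<longleftrightarrow> map (c S) xs \<in> T" .
    qed (use B[OF S] c(2)[OF S] cc[OF S] F in \<open>auto intro: finite_subset\<close>)
    thus ?thesis using sim_trans sim_sym c(1)[OF S] by blast
  qed
  thus ?thesis using aF by blast
qed

text \<open>With coordinate \<open>i\<close> moved to \<open>z\<close>, the permutation sends the
  unique ordering in \<open>T\<close> of the other \<open>k\<close> points to an ordering in
  \<open>T\<close> of the same set. By uniqueness it fixes every entry.\<close>

lemma sim_semiregular: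
  assumes S: "card S = Suc k" and \<sigma>: "\<sigma> permutes S" and i: "i \<in> S" "\<sigma> i = i"
    and x: "sim S (x \<circ> \<sigma>) x"
  shows "\<sigma> = id"
proof -
  have fS: "finite S" using S by (simp add: card_ge_0_finite)
  have xx: "sim S x x" using sim_trans[OF sim_sym[OF x] x] .
  obtain y where y: "sim S x y" "y i = z" using ex_normalize[OF xx i(1)] by blast
  have yy: "sim S y y" using sim_trans[OF sim_sym[OF y(1)] y(1)] .
  have inj: "inj_on y S" using simD(1)[OF yy] .
  have "sim S (y \<circ> \<sigma>) y"
    using sim_trans[OF sim_trans[OF sim_relabel[OF sim_sym[OF y(1)], of \<sigma>] x] y(1)]
      permutes_inj_on[OF \<sigma>] permutes_image[OF \<sigma>] by auto
  have \<sigma>i: "\<sigma> ` (S - {i}) = S - {i}"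
    using i permutes_image[OF \<sigma>] permutes_inj_on[OF \<sigma>, of UNIV]
    by (metis image_insert image_is_empty image_set_diff insert_is_Un inj_on_def)
  have "card (y ` (S - {i})) = k"
    using card_image[OF inj_on_subset[OF inj]] S i by (simp add: card_Diff_singleton)
  hence "\<exists>!ys. set ys = y ` (S - {i}) \<and> distinct ys \<and> ys \<in> T"
    using normalized_in[OF yy i(1) y(2)] fS by (intro unique) auto
  then obtain ys where ys: "set ys = y ` (S - {i})" "distinct ys" "ys \<in> T"
    and uq: "\<And>ys'. set ys' = y ` (S - {i}) \<Longrightarrow> distinct ys' \<Longrightarrow> ys' \<in> T \<Longrightarrow> ys' = ys" by metis
  let ?xs = "map (inv_into (S - {i}) y) ys"
  have e: "map y ?xs = ys" using ys(1) unfolding map_map by (intro map_idI) (simp add: f_inv_into_f)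
  have sx: "set ?xs = S - {i}"
    using ys(1) inj_on_subset[OF inj, of "S - {i}"] by (simp add: image_comp inv_into_image_cancel)
  have dx: "distinct ?xs" using e ys(2) by (metis distinct_map)
  have "length ?xs = k" using distinct_card[OF dx] sx S i by (simp add: card_Diff_singleton)
  hence nl: "?xs \<in> nlists k (S - {i})" using sx by (simp add: nlists_def)
  have "map (y \<circ> \<sigma>) ?xs \<in> T"
    using sim_normalizedD[OF \<open>sim S (y \<circ> \<sigma>) y\<close> i(1) _ y(2) nl] y(2) i(2) e ys(3) by simp
  moreover have "set (map (y \<circ> \<sigma>) ?xs) = y ` (S - {i})"
    using sx \<sigma>i by (metis image_comp list.set_map)
  ultimately have "map (y \<circ> \<sigma>) ?xs = map y ?xs"
    using uq distinct e by metis
  hence "y (\<sigma> j) = y j" if "j \<in> S - {i}" for j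
    using that sx by (metis comp_apply map_eq_conv)
  hence "\<sigma> j = j" if "j \<in> S" for j
    using that i inj permutes_in_image[OF \<sigma>] by (cases "j = i") (auto simp: inj_on_def)
  thus ?thesis using permutes_not_in[OF \<sigma>] by (metis eq_id_iff)
qed

lemma tuple_types: "tuple_types sim (Suc k)"
proof (rule tuple_types.intro)
  show "sim S a b" if "sim S a a" "\<And>i. i \<in> S \<Longrightarrow> a i = b i" for S a b
    by (rule sim_cong[OF simD(1,2)[OF that(1)] that(2)])
  show "4 \<le> Suc k" using k by simp
qed (fact sim_sym sim_trans sim_relabel sim_determined sim_free sim_semiregular)+

end

section \<open>The generic hypertournament\<close>

lemma hypertournament_lang_simps [simp]:
  "fun_syms (hypertournament_lang k) = {}" "rel_syms (hypertournament_lang k) = {()}"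
  "rel_arity (hypertournament_lang k) r = k"
  by (simp_all add: hypertournament_lang_def)

lemma finitely_generated_if_finite:
  assumes "finite (universe A)"
  shows "finitely_generated (hypertournament_lang k) A"
proof -
  have "generated (hypertournament_lang k) A (universe A) = universe A"
    by (auto simp: generated_def subuniverse_def)
  thus ?thesis using assms by (auto simp: finitely_generated_def)
qed

lemma embedding_hypertournament_iff:
  "embedding (hypertournament_lang k) A B h \<longleftrightarrow>
     inj_on h (universe A) \<and> h ` universe A \<subseteq> universe B \<and>
     (\<forall>xs\<in>nlists k (universe A). map h xs \<in> rel_of B () \<longleftrightarrow> xs \<in> rel_of A ())"
  by (auto simp: embedding_def)

context
  fixes k :: nat and M :: "(unit, unit, 'a) fo_structure"
  assumes generic: "generic_hypertournament k M"
begin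

lemma generic_rel_nlists: "rel_of M () \<subseteq> nlists k (universe M)"
  using generic by (simp add: generic_hypertournament_def fo_structure_def)

lemma generic_age:
  "age (hypertournament_lang k) M =
     {A :: (unit, unit, nat) fo_structure. hypertournament k A \<and> finite (universe A)}"
  using generic by (simp add: generic_hypertournament_def)

text \<open>The pulled-back structure embeds into \<open>M\<close> by \<open>e\<close>, so it
  belongs to the age, all of whose members are hypertournaments.\<close>

lemma generic_pullback:
  fixes e :: "nat \<Rightarrow> 'a"
  assumes "finite U" "inj_on e U" "e ` U \<subseteq> universe M"
  shows "hypertournament k \<lparr>universe = U, fun_of = \<lambda>_ _. undefined,
    rel_of = \<lambda>_. {xs \<in> nlists k U. map e xs \<in> rel_of M ()}\<rparr>" (is "hypertournament k ?A")
proof -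
  have "fo_structure (hypertournament_lang k) ?A" by (auto simp: fo_structure_def)
  moreover have "finitely_generated (hypertournament_lang k) ?A"
    using assms by (simp add: finitely_generated_if_finite)
  moreover have "embedding (hypertournament_lang k) ?A M e"
    unfolding embedding_hypertournament_iff using assms by simp
  ultimately have "?A \<in> age (hypertournament_lang k) M" unfolding age_def by blast
  thus ?thesis unfolding generic_age by blast
qed

text \<open>The age only speaks about structures on \<^typ>\<open>nat\<close>, so finite subsets of \<open>M\<close> are
  inspected through an enumeration.\<close>

lemma generic_chart:
  assumes "finite X" "X \<subseteq> universe M"
  obtains e :: "nat \<Rightarrow> 'a" and U where "bij_betw e U X"
    "\<And>xs. xs \<in> nlists k U \<Longrightarrow> map e xs \<in> rel_of M () \<Longrightarrow> distinct xs"
    "\<And>S. S \<subseteq> U \<Longrightarrow> card S = k \<Longrightarrow>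
      \<exists>!xs. set xs = S \<and> distinct xs \<and> xs \<in> nlists k U \<and> map e xs \<in> rel_of M ()"
proof -
  obtain e where e: "bij_betw e {0..<card X} X" using ex_bij_betw_nat_finite[OF assms(1)] by blast
  hence *: "hypertournament k \<lparr>universe = {0..<card X}, fun_of = \<lambda>_ _. undefined,
    rel_of = \<lambda>_. {xs \<in> nlists k {0..<card X}. map e xs \<in> rel_of M ()}\<rparr>"
    by (intro generic_pullback) (use assms in \<open>auto simp: bij_betw_def\<close>)
  show ?thesis
  proof (rule that[OF e])
    show "distinct xs" if "xs \<in> nlists k {0..<card X}" "map e xs \<in> rel_of M ()" for xs
      using * that by (simp add: hypertournament_def)
    fix S assume "S \<subseteq> {0..<card X}" "card S = k"
    moreover from this have "finite S" using finite_subset by blast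
    ultimately show "\<exists>!xs. set xs = S \<and> distinct xs \<and> xs \<in> nlists k {0..<card X} \<and> map e xs \<in> rel_of M ()"
      using * by (simp add: hypertournament_def)
  qed
qed

lemma map_inv_into:
  assumes "bij_betw e U X" "set xs \<subseteq> X"
  shows "map e (map (inv_into U e) xs) = xs" "set (map (inv_into U e) xs) \<subseteq> U"
proof -
  have X: "X = e ` U" using assms by (simp add: bij_betw_def)
  show "map e (map (inv_into U e) xs) = xs"
    unfolding map_map using assms(2) by (intro map_idI) (auto simp: X f_inv_into_f)
  show "set (map (inv_into U e) xs) \<subseteq> U"
    using assms(2) unfolding X by (auto intro: inv_into_into)
qed

lemma generic_distinct:
  assumes xs: "xs \<in> rel_of M ()" shows "distinct xs"
proof -
  have nl: "length xs = k" "set xs \<subseteq> universe M"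
    using generic_rel_nlists xs by (auto simp: nlists_def)
  obtain e :: "nat \<Rightarrow> 'a" and U where e: "bij_betw e U (set xs)"
    and d: "\<And>xs. xs \<in> nlists k U \<Longrightarrow> map e xs \<in> rel_of M () \<Longrightarrow> distinct xs"
    using generic_chart[OF finite_set nl(2)] by metis
  let ?ys = "map (inv_into U e) xs"
  note ys = map_inv_into[OF e order.refl]
  have "distinct ?ys" using d[of ?ys] ys xs nl by (simp add: nlists_def)
  hence "distinct (map e ?ys)"
    unfolding distinct_map[of e] using ys(2) e by (auto simp: bij_betw_def intro: inj_on_subset)
  thus ?thesis by (simp only: ys(1))
qed

lemma generic_unique:
  assumes S: "S \<subseteq> universe M" "finite S" "card S = k"
  shows "\<exists>!xs. set xs = S \<and> distinct xs \<and> xs \<in> rel_of M ()"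
proof -
  obtain e :: "nat \<Rightarrow> 'a" and U where e: "bij_betw e U S"
    and u: "\<And>S. S \<subseteq> U \<Longrightarrow> card S = k \<Longrightarrow>
      \<exists>!xs. set xs = S \<and> distinct xs \<and> xs \<in> nlists k U \<and> map e xs \<in> rel_of M ()"
    using generic_chart[OF S(2,1)] by metis
  have inj: "inj_on e U" "e ` U = S" using e by (auto simp: bij_betw_def)
  have "card U = k" using card_image[OF inj(1)] inj(2) S(3) by simp
  from u[OF order.refl this] obtain ys where ys: "set ys = U" "distinct ys" "map e ys \<in> rel_of M ()"
    and uq: "\<And>zs. set zs = U \<Longrightarrow> distinct zs \<Longrightarrow> zs \<in> nlists k U \<Longrightarrow> map e zs \<in> rel_of M () \<Longrightarrow> zs = ys"
    by metis
  show ?thesis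
  proof (rule ex1I[of _ "map e ys"])
    show "set (map e ys) = S \<and> distinct (map e ys) \<and> map e ys \<in> rel_of M ()"
      using ys inj by (simp add: distinct_map)
    fix xs assume xs: "set xs = S \<and> distinct xs \<and> xs \<in> rel_of M ()"
    let ?zs = "map (inv_into U e) xs"
    have zs: "map e ?zs = xs" "set ?zs \<subseteq> U" using map_inv_into[OF e, of xs] xs by simp_all
    have "length xs = k" using xs S(3) distinct_card by metis
    moreover have "set ?zs = U" using xs inj by (auto simp: image_iff)
    moreover have "distinct ?zs" using zs(1) xs distinct_map[of e ?zs] by simp
    moreover have "map e ?zs \<in> rel_of M ()" unfolding zs(1) using xs by blast
    ultimately have "?zs = ys" using uq zs(2) by (simp add: nlists_def)
    thus "xs = map e ys" using zs(1) by simp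
  qed
qed

text \<open>Without function symbols every subset is a subuniverse and every finite one is finitely
  generated, so ultrahomogeneity covers all finite partial isomorphisms.\<close>

lemma generic_homogeneous:
  assumes A: "finite A" "A \<subseteq> universe M" and h: "inj_on h A" "h ` A \<subseteq> universe M"
    and hT: "\<And>xs. xs \<in> nlists k A \<Longrightarrow> map h xs \<in> rel_of M () \<longleftrightarrow> xs \<in> rel_of M ()"
  shows "\<exists>g\<in>carrier (Aut (hypertournament_lang k) M). \<forall>x\<in>A. g x = h x"
proof -
  let ?L = "hypertournament_lang k"
  have "isomorphism ?L (induced M A) (induced M (h ` A)) h"
    unfolding isomorphism_def embedding_hypertournament_iff
    using h hT by (auto simp: induced_def nlists_def)
  moreover have "finitely_generated ?L (induced M A)" "finitely_generated ?L (induced M (h ` A))"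
    by (rule finitely_generated_if_finite, use A in \<open>simp add: induced_def\<close>)+
  moreover have "subuniverse ?L M A" "subuniverse ?L M (h ` A)"
    using A h by (auto simp: subuniverse_def)
  ultimately show ?thesis
    using generic unfolding generic_hypertournament_def ultrahomogeneous_def by blast
qed

lemma generic_universal:
  assumes U: "finite (U :: nat set)" and R: "R \<subseteq> nlists k U" "\<And>xs. xs \<in> R \<Longrightarrow> distinct xs"
    "\<And>S. S \<subseteq> U \<Longrightarrow> card S = k \<Longrightarrow> \<exists>!xs. set xs = S \<and> distinct xs \<and> xs \<in> R"
  shows "\<exists>h. inj_on h U \<and> h ` U \<subseteq> universe M \<and>
    (\<forall>xs\<in>nlists k U. map h xs \<in> rel_of M () \<longleftrightarrow> xs \<in> R)"
proof -
  let ?A = "\<lparr>universe = U, fun_of = \<lambda>_ _. undefined, rel_of = \<lambda>_. R\<rparr> :: (unit, unit, nat) fo_structure"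
  have "hypertournament k ?A"
    unfolding hypertournament_def using R by (simp add: fo_structure_def)
  hence "?A \<in> age (hypertournament_lang k) M" unfolding generic_age using U by simp
  thus ?thesis unfolding age_def embedding_hypertournament_iff by auto
qed

section \<open>From the one-point extension to its permutation group\<close>

text \<open>The stabiliser equation is used in both directions: elements fixing \<open>z\<close>
  restrict to automorphisms of \<open>M\<close>, which gives invariance of the relation, and
  automorphisms of \<open>M\<close> lift to elements fixing \<open>z\<close>, which gives
  homogeneity.\<close>

lemma transitive_extensionI:
  assumes k: "2 < k" and ext: "transitive_one_point_extension (hypertournament_lang k) M z L' M'"
  shows "transitive_extension k (universe M) (rel_of M ()) z (carrier (Aut L' M'))"
proof -
  let ?L = "hypertournament_lang k" and ?G = "carrier (Aut L' M')"
  have M': "fo_structure L' M'" "z \<notin> universe M" "universe M' = insert z (universe M)"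
    and stab: "(\<lambda>g. restrict g (universe M)) ` stabilizer (Aut L' M') (\<lambda>g. g) z = carrier (Aut ?L M)"
    and tr: "transitive_action (Aut L' M') (universe M') (\<lambda>g. g)"
    using ext by (auto simp: transitive_one_point_extension_def one_point_extension_def)
  interpret transitive_action "Aut L' M'" "universe M'" "\<lambda>g. g" by (rule tr)
  interpret grp: group "Aut L' M'" using group_hom group_hom.axioms(1) by auto
  show ?thesis
  proof (rule transitive_extension.intro)
    show "bij_betw g (insert z (universe M)) (insert z (universe M))" if "g \<in> ?G" for g
      using bij_prop0[OF that] by (simp add: M'(3) Bij_def)
    have "\<forall>x\<in>insert z (universe M). \<one>\<^bsub>Aut L' M'\<^esub> x = x"
      using id_eq_one[symmetric] by (simp add: M'(3))
    thus "\<exists>g\<in>?G. \<forall>x\<in>insert z (universe M). g x = x" using grp.one_closed by blast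
    show "\<exists>f\<in>?G. \<forall>x\<in>insert z (universe M). f x = g (h x)" if "g \<in> ?G" "h \<in> ?G" for g h
    proof
      show "g \<otimes>\<^bsub>Aut L' M'\<^esub> h \<in> ?G" using grp.m_closed[OF that] .
      show "\<forall>x\<in>insert z (universe M). (g \<otimes>\<^bsub>Aut L' M'\<^esub> h) x = g (h x)"
        unfolding M'(3)[symmetric] by (intro ballI composition_rule that)
    qed
    show "\<exists>h\<in>?G. \<forall>x\<in>insert z (universe M). h (g x) = x" if "g \<in> ?G" for g
    proof
      show "inv\<^bsub>Aut L' M'\<^esub> g \<in> ?G" using grp.inv_closed[OF that] .
      show "\<forall>x\<in>insert z (universe M). (inv\<^bsub>Aut L' M'\<^esub> g) (g x) = x"
        unfolding M'(3)[symmetric] by (intro ballI orbit_sym_aux[OF that _ HOL.refl])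
    qed
    show "\<exists>g\<in>?G. g x = z" if "x \<in> insert z (universe M)" for x
      using unique_orbit[of x z] that by (simp add: M'(3))
    show "map g xs \<in> rel_of M () \<longleftrightarrow> xs \<in> rel_of M ()"
      if g: "g \<in> ?G" "g z = z" and xs: "xs \<in> nlists k (universe M)" for g xs
    proof -
      let ?g = "restrict g (universe M)"
      have "g \<in> stabilizer (Aut L' M') (\<lambda>g. g) z" using g by (simp add: stabilizer_def)
      hence "?g \<in> carrier (Aut ?L M)" unfolding stab[symmetric] by (rule imageI)
      hence "map ?g xs \<in> rel_of M () \<longleftrightarrow> xs \<in> rel_of M ()"
        using xs unfolding Aut_def isomorphism_def embedding_hypertournament_iff by simp
      moreover have "map ?g xs = map g xs" using xs by (auto simp: nlists_def)
      ultimately show ?thesis by simp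
    qed
    show "\<exists>g\<in>?G. g z = z \<and> (\<forall>x\<in>A. g x = h x)"
      if A: "finite A" "A \<subseteq> universe M" and h: "inj_on h A" "h ` A \<subseteq> universe M"
        and hT: "\<And>xs. xs \<in> nlists k A \<Longrightarrow> map h xs \<in> rel_of M () \<longleftrightarrow> xs \<in> rel_of M ()" for A h
    proof -
      obtain f where f: "f \<in> carrier (Aut ?L M)" "\<forall>x\<in>A. f x = h x"
        using generic_homogeneous[OF A h hT] by blast
      then obtain g where g: "g \<in> stabilizer (Aut L' M') (\<lambda>g. g) z" "f = restrict g (universe M)"
        unfolding stab[symmetric] by (elim imageE)
      have "\<forall>x\<in>A. g x = h x"
      proof
        fix x assume "x \<in> A"
        thus "g x = h x" using f(2) A(2) by (simp add: g(2) subset_iff)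
      qed
      thus ?thesis using g(1) by (auto simp: stabilizer_def)
    qed
  qed (fact k M'(2) generic_unique generic_distinct generic_universal)+
qed

end

theorem proposition4p8:
  fixes k :: nat
    and M :: "(unit, unit, 'a) fo_structure"
  assumes "k > 2"
    and "generic_hypertournament k M"
  shows "\<nexists>z (L' :: ('f, 'r) language) M'.
           transitive_one_point_extension (hypertournament_lang k) M z L' M'"
proof (intro notI, elim exE)
  fix z and L' :: "('f, 'r) language" and M'
  assume "transitive_one_point_extension (hypertournament_lang k) M z L' M'"
  from transitive_extensionI[OF assms(2,1) this]
  have "tuple_types (same_orbit (insert z (universe M)) (carrier (Aut L' M'))) (Suc k)"
    by (rule transitive_extension.tuple_types)
  thus False by (rule tuple_types.inconsistent)
qed

end
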